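(* Let $A$ be an honest participant, and let $\Gamma$ be a concrete BitML configuration reachable, via the concrete semantics $\to_\flat$, from an initial configuration. Let $x \in \mathcal{X} \subseteq \mathrm{cn}(\Gamma)$. If $x$ is liquid in the abstract configuration $\alpha_{A,\mathcal{X}}(\Gamma)$ with respect to the abstract LTS $\to_\sharp$ and the label set $\mathcal{L}^\sharp$, then $x$ is liquid in $\Gamma$ with respect to the concrete LTS $\to_\flat$ and the label set $\mathcal{L}^\flat_A$.
   Context: **Syntax.** Fix: participants $P,Q,\dots$, with a subset $\mathrm{Hon}$ of honest participants; a set of names $x,y,z,\dots$ (used both for deposits and for contracts); deposit variables $d,e,\dots$; secret names $a,b,\dots$, with a set $S_P$ of secret names usable by each participant $P$, where $S_P\cap S_Q=\emptyset$ if $P\ne Q$; a finite set of recursion variables $\mathsf X,\mathsf Y,\dots$; integer variables $\beta$. $\chi$ ranges over names and deposit variables; $v,w$ over non-negative rationals. Static expressions $\mathcal E$ are built from integer constants and integer variables with the usual arithmetic operators; a closed one evaluates to an integer $[\![\mathcal E]\!]$. A vector $\vec{\cdot}$ is a finite sequence. A "fresh" name is one not already in use. *Preconditions:* $G ::= P{:}v@\chi \mid P{:}\mathtt{secret}\,a\ (a\in S_P) \mid (G\,|\,G)$, with the $\chi$'s in $G$ distinct. *Contracts:* $C ::= \sum_{i\in I} D_i$ ($I$ finite; $0$ is the empty sum). *Guarded contracts:* $D ::= \mathtt{withdraw}\,P \mid \mathtt{reveal}\,\vec a\ \mathtt{if}\ p\,.\,C \mid \mathtt{split}\,\|_{i}(w_i\to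 C_i) \mid P{:}D \mid \mathtt{after}\ \mathcal E{:}D \mid {*}{:}\mathtt{rngt}\ \mathsf X\langle\vec{\mathcal E}\rangle$. Predicates: $p ::= \mathit{true}\mid p\wedge p\mid \neg p\mid E=E\mid E<E$, with $E ::= \mathcal E\mid a\mid E+E\mid E-E$. In $\mathtt{reveal}\,\vec a\ \mathtt{if}\ p$ the names $\vec a$ are distinct and include those in $p$. Each $\mathsf X$ has a unique defining equation $\mathsf X(\vec\beta)=\{G\}C$, and uses of $\mathsf X$ have the right number of arguments. The order of decorations $P{:}$, $\mathtt{after}\ \mathcal E{:}$ is immaterial. *Advertisements* $\{G\}^{\circ}C$, with $\circ$ empty or a name, satisfy: each secret name in $C$ occurs in $G$; $G$ requires a deposit from each participant in the advertisement; each ${*}{:}\mathtt{rngt}\,\mathsf X\langle\vec{\mathcal E}\rangle$ in $C$ refers to a defining equation $\mathsf X(\vec\beta)=\{G'\}C'$ where $G'$ has the same participants as $G$. *Configurations* are parallel compositions ($|$ with unit $0$, a commutative monoid) of: advertisements $\{G\}^\circ C$; active contracts $\langle C,v\rangle_x$; deposits $\langle P,v\rangle_x$; authorizations $P[\xi]$; committed secrets $\{P{:}a\#N\}$ ($N\in\mathbb N\cup\{\bot\}$); revealed secrets $P{:}a\#N$ ($N\in\mathbb N$); bindings $P{:}d\leftarrow x$; a time term $t$ (at most one occurrence). There are no duplicate authorizations, and two terms $\langle\cdots\rangle_x$, $\langle\cdots\rangle_y$ in a configuration have $x\neq y$. Here $\xi$ is one of: $\#\rhd\{G\}^\circ C$;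 $x\rhd\{G\}^\circ C$; $x\rhd D$; $x,y\rhd\langle P,v\rangle$; $x\rhd\langle P,v\rangle,\langle P,v'\rangle$; $x\rhd Q$; $\vec x,i\rhd y$. $\mathrm{cn}(\Gamma)$ is the set of $x$ such that $\Gamma$ contains some active contract $\langle C,v\rangle_x$. A configuration is *timed* if it contains a time term; an *initial* configuration consists of deposits only (together with a time term, since runs start from timed configurations). **Concrete semantics** $\Gamma\xrightarrow{\ell}_\flat\Gamma'$ between timed configurations (in the rules, $\Gamma$ is an arbitrary remaining part, possibly including $t$; the label is given in brackets): - Deposits. $\langle P,v\rangle_x|\langle P,v'\rangle_y|\Gamma$ adds $P[x,y\rhd\langle P,v+v'\rangle]$ [$P{:}x,y$]; with both $P[x,y\rhd\langle P,v+v'\rangle]$ and $P[y,x\rhd\langle P,v+v'\rangle]$ present, the two deposits and these authorizations are replaced by $\langle P,v+v'\rangle_z$, $z$ fresh [$\mathit{join}(x,y)$]. $\langle P,v+v'\rangle_x$ allows adding $P[x\rhd\langle P,v\rangle,\langle P,v'\rangle]$ [$P{:}x,v,v'$]; with it, deposit and authorization are replaced by $\langle P,v\rangle_y|\langle P,v'\rangle_{y'}$, $y,y'$ fresh [$\mathit{divide}(x,v,v')$]. $\langle P,v\rangle_x$ allows adding $P[x\rhd Q]$ [$P{:}x,Q$]; with it, both are replaced by $\langle Q,v\rangle_y$, $y$ fresh [$\mathit{donate}(x,Q)$]. Given $\|_{i=1}^n\langle P_i,v_i\rangle_{x_i}$, $\vec x=x_1\cdots x_n$, one can add $P_j[\vec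 x,j\rhd y]$, $y$ fresh except in destroy authorizations for $\vec x$ [$P_j{:}\vec x,j$]; when $P_i[\vec x,i\rhd y]$ are present for all $i$, all these deposits and authorizations are removed [$\mathit{destroy}(\vec x)$]. - C-Adv: if for each $P{:}v@x$ in $G$ ($x$ a name) $\langle P,v\rangle_x$ is in $\Gamma$, and all secrets in $G$ are fresh, then $\Gamma\to\{G\}C|\Gamma$ [$\mathit{adv}(\{G\}C)$]. - C-AuthCommit: $\{G\}^\circ C|\Gamma\to\{G\}^\circ C|\Gamma|\Delta_s|\Delta_d|P[\#\rhd\{G\}^\circ C]$ [$P{:}\{G\}^\circ C,\Delta_s|\Delta_d$], where $\Delta_s=\|_{i=1}^k\{P{:}a_i\#N_i\}$ for $a_1,\dots,a_k$ all the secrets of $P$ in $G$, none of which already occurs committed or revealed by $P$ in $\Gamma$, with $N_i\in\mathbb N$ if $P\in\mathrm{Hon}$ and $N_i\in\mathbb N\cup\{\bot\}$ otherwise; $\Delta_d=\|_{i=1}^h P{:}d_i\leftarrow x_i$ for $d_1,\dots,d_h$ all the deposit variables of $P$ in $G$ (with $P{:}v_i@d_i$ in $G$), with no binding of $P$ for $d_i$ in $\Gamma$, $\langle P,v_i\rangle_{x_i}$ in $\Gamma$, the $x_i$ pairwise distinct and different from every name $x$ with $P{:}v@x$ in $G$. - C-AuthInitDep: if $Q[\#\rhd\{G\}^\circ C]$ is in $\Gamma$ for all $Q$ in $G$, and either $P{:}v@\chi$ is in $G$ with $\chi=x$ or ($\chi=d$ and $P{:}d\leftarrow x$ in $\Gamma$),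 or $\circ=x$ and $P$ occurs in $G$, then $\{G\}^\circ C|\Gamma\to\{G\}^\circ C|\Gamma|P[x\rhd\{G\}^\circ C]$ [$P{:}\{G\}^\circ C,x$]. - C-Init: let $G=(\|_{i\in I}P_i{:}v_i@x_i)|(\|_{i\in J}Q_i{:}v'_i@d_i)|(\|_{i\in K}R_i{:}\mathtt{secret}\,a_i)$, and let $\Delta$ consist of $\langle P_i,v_i\rangle_{x_i}$ and $P_i[x_i\rhd\{G\}C]$ ($i\in I$), of $\langle Q_i,v'_i\rangle_{x'_i}$, $Q_i{:}d_i\leftarrow x'_i$ and $Q_i[x'_i\rhd\{G\}C]$ ($i\in J$), and of $P[\#\rhd\{G\}C]$ for all $P$ in $G$. Then $\{G\}C|\Delta|\Gamma\to\langle C,\sum_I v_i+\sum_J v'_i\rangle_z|\Gamma$, $z$ fresh [$\mathit{init}(G,C)$]. - C-Withdraw: $\langle\mathtt{withdraw}\,P,v\rangle_x|\Gamma\to\langle P,v\rangle_y|\Gamma$, $y$ fresh [$\mathit{withdraw}(P,v,x)$]. - C-Split: if $w=\sum_{i=1}^k w_i$, $v_i=(v\cdot w_i)/w$ and $y_1,\dots,y_k$ are fresh, then $\langle\mathtt{split}\,\|_{i=1}^k(w_i\to C_i),v\rangle_x|\Gamma\to\|_{i=1}^k\langle C_i,v_i\rangle_{y_i}|\Gamma$ [$\mathit{split}(x)$]. - C-AuthRev: $\{P{:}a\#N\}|\Gamma\to P{:}a\#N|\Gamma$ if $N\ne\bot$ [$P{:}a$]. - C-Rev: if $\Delta=\|_{i=1}^n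 Q_i{:}a_i\#N_i$, $\vec a=a_1\cdots a_n$, and $p$ is true when each $a_i$ is evaluated as $N_i$, then $\langle\mathtt{reveal}\,\vec a\ \mathtt{if}\ p.C,v\rangle_x|\Gamma|\Delta\to\langle C,v\rangle_y|\Gamma|\Delta$, $y$ fresh [$\mathit{rev}(\vec a,y)$]. - C-AuthBranch: $\langle P{:}D+C,v\rangle_x|\Gamma\to\langle P{:}D+C,v\rangle_x|P[x\rhd P{:}D]|\Gamma$ [$P{:}(x,P{:}D)$]. - C-Branch: if $D=P_1{:}\cdots P_k{:}\mathtt{after}\ t_1{:}\cdots\mathtt{after}\ t_m{:}D'$ (the $t_i$ being values of closed static expressions), $D'$ is not of the form $P{:}\cdots$ or $\mathtt{after}\ t'{:}\cdots$, $\langle D',v\rangle_x|\Gamma\xrightarrow{\ell}_\flat\Gamma'$ with $x\notin\mathrm{cn}(\Gamma')$, and $t\ge t_1,\dots,t_m$, then $\langle D+C,v\rangle_x|\,\|_{i=1}^kP_i[x\rhd D]\,|\Gamma|t\xrightarrow{\ell}_\flat\Gamma'|t$. - C-Delay: $\Gamma|t\to\Gamma|t+\delta$ for $\delta>0$ [$\delta$]. - Write $\{G\}C\equiv\mathsf X\langle\vec{\mathcal E}\rangle$ if $\{G\}C$ is $\alpha$-equivalent (w.r.t. secret names and deposit variables) to the advertisement obtained from the defining equation $\mathsf X(\vec\beta)=\{G'\}C'$ by replacing $\vec\beta$ with $[\![\vec{\mathcal E}]\!]$ and evaluating the static expressions. C-AdvRngt: if $\{G\}C\equiv\mathsf X\langle\vec{\mathcal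 E}\rangle$, the secrets and deposit variables of $G$ are fresh, no $\{G'\}^xC'$ in $\Gamma$ has $\{G'\}C'\equiv\mathsf X\langle\vec{\mathcal E}\rangle$, and each $P{:}v@y$ in $G$ with $y$ a name has $\langle P,v\rangle_y$ in $\Gamma$, then $\langle{*}{:}\mathtt{rngt}\,\mathsf X\langle\vec{\mathcal E}\rangle+C_{alt},v\rangle_x|\Gamma$ adds $\{G\}^xC$ [$\mathit{advRngt}(\{G\}^xC)$]. - C-Rngt: if $\{G\}C\equiv\mathsf X\langle\vec{\mathcal E}\rangle$, with $G$ and $\Delta$ as in C-Init but with $\{G\}^xC$ in place of $\{G\}C$ in authorizations and $\Delta$ additionally containing $P[x\rhd\{G\}^xC]$ for all $P$ in $G$, then $\langle{*}{:}\mathtt{rngt}\,\mathsf X\langle\vec{\mathcal E}\rangle+C_{alt},v\rangle_x|\{G\}^xC|\Gamma|\Delta\to\langle C,v+\sum_Iv_i+\sum_Jv'_i\rangle_y|\Gamma$, $y$ fresh [$\mathit{rngt}(x,G,C)$]. $\mathcal L^\flat_A$ is the set of all concrete labels except those of the form $P{:}\cdots$ with $P\ne A$. **Abstraction.** For a participant $A$: $\alpha_A(\sum_iD_i)=\sum_i\alpha_A(D_i)$; $\alpha_A(\mathtt{withdraw}\,P)=\mathtt{withdraw}\,P$; $\alpha_A(\mathtt{reveal}\,\vec a\ \mathtt{if}\ p.C)$ is $\tau.\alpha_A(C)$ if $p=\mathit{true}$ and $\vec a\subseteq S_A$, and ${*}{:}\tau.\alpha_A(C)$ otherwise; $\alpha_A(\mathtt{split}\,\|_i(w_i\to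 C_i))=\mathtt{split}\,\|_i(\to\alpha_A(C_i))$; $\alpha_A(P{:}D)$ is $\alpha_A(D)$ if $P=A$ and ${*}{:}\alpha_A(D)$ otherwise; $\alpha_A(\mathtt{after}\ \mathcal E{:}D)=\alpha_A(D)$; $\alpha_A({*}{:}\mathtt{rngt}\,\mathsf X\langle\vec{\mathcal E}\rangle)={*}{:}\mathtt{rngt}\,\mathsf X$. Each $\mathsf X(\vec\beta)=\{G\}C$ is abstracted as $\mathsf X=_\sharp\alpha_A(C)$. For a set $\mathcal X$ of names: $\alpha_{A,\mathcal X}(\Delta|\Delta')=\alpha_{A,\mathcal X}(\Delta)|\alpha_{A,\mathcal X}(\Delta')$; $\alpha_{A,\mathcal X}(\langle C,v\rangle_x)=\langle\alpha_A(C)\rangle_x$ if $x\in\mathcal X$; every other single term is mapped to $0$. Abstract configurations are parallel compositions of terms $\langle C\rangle_x$ ($C$ an abstract contract) and recursion variables $\mathsf X$; $\mathrm{cn}$ is the set of $x$ of its terms $\langle C\rangle_x$. ${*}{:}{*}{:}D$ is identified with ${*}{:}D$. **Abstract semantics** $\xrightarrow{\ell}_\sharp$, with labels $x$ or ${*}{:}x$ (${*}{:}{*}{:}\ell$ identified with ${*}{:}\ell$; $\mathrm{cn}(x)=\mathrm{cn}({*}{:}x)=\{x\}$): $\langle\mathtt{withdraw}\,P\rangle_x|\Gamma\xrightarrow{x}_\sharp\Gamma$; $\langle\tau.C\rangle_x|\Gamma\xrightarrow{x}_\sharp\langle C\rangle_y|\Gamma$, $y$ fresh; $\langle\mathtt{split}\,\|_i(\to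 C_i)\rangle_x|\Gamma\xrightarrow{x}_\sharp\|_i\langle C_i\rangle_{y_i}|\Gamma$, $y_i$ fresh; if $\langle D\rangle_x|\Gamma\xrightarrow{\ell}_\sharp\Gamma'$ and $x\in\mathrm{cn}(\ell)$ then $\langle D+C\rangle_x|\Gamma\xrightarrow{\ell}_\sharp\Gamma'$ and $\langle{*}{:}D\rangle_x|\Gamma\xrightarrow{{*}:\ell}_\sharp\Gamma'$; if $\mathsf X=_\sharp C$ then $\langle{*}{:}\mathtt{rngt}\,\mathsf X\rangle_x|\Gamma\xrightarrow{{*}:x}_\sharp\langle C\rangle_y|\mathsf X|\Gamma$, $y$ fresh. $\mathcal L^\sharp$ is the set of labels of the form $x$. **Origin and liquidity** (for any LTS $\to$ on configurations). For a run $\mathcal R$ from $\Gamma$, the partial function $\mathrm{orig}_\Gamma$ is: $\mathrm{orig}_\Gamma(\Gamma,x)=x$ if $x\in\mathrm{cn}(\Gamma)$; and, if $\Gamma_{\mathcal R}$ is the last configuration of $\mathcal R$, $\mathrm{orig}_\Gamma(\mathcal R\xrightarrow{\ell}\Gamma',x)$ equals $\mathrm{orig}_\Gamma(\mathcal R,x)$ if $x\in\mathrm{cn}(\Gamma_{\mathcal R})\cap\mathrm{cn}(\Gamma')$, and equals $\mathrm{orig}_\Gamma(\mathcal R,y)$ if $x\in\mathrm{cn}(\Gamma')\setminus\mathrm{cn}(\Gamma_{\mathcal R})$ and $\{y\}=\mathrm{cn}(\Gamma_{\mathcal R})\setminus\mathrm{cn}(\Gamma')$; undefined otherwise. Given a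 set of labels $\mathcal L$: a name $x$ is *liquidable* in $\Gamma$ if there is a finite run $\mathcal R=\Gamma\xrightarrow{\ell_1}\cdots\xrightarrow{\ell_n}\Gamma'$ with all $\ell_i\in\mathcal L$ such that no $z\in\mathrm{cn}(\Gamma')$ has $\mathrm{orig}_\Gamma(\mathcal R,z)=x$. A name $x$ is *liquid* in $\Gamma$ if for all finite runs $\mathcal R=\Gamma\to\cdots\to\Gamma'$ (any labels), every $y$ with $\mathrm{orig}_\Gamma(\mathcal R,y)=x$ is liquidable in $\Gamma'$.
   Formalization: In C-Branch a repeated decoration such as A:A:D needs one authorization per distinct participant (two equal ones cannot coexist, so literally the claim fails there), and a split of total weight 0, where (v·w_i)/w is undefined, gives parts of value 0. *)

theory Defs
  imports Complex_Main "HOL-Library.Multiset"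
begin

section \<open>Syntax\<close>

type_synonym name = nat
type_synonym depvar = nat
type_synonym secret = nat
type_synonym intvar = nat

datatype (svars: 'b) sexp =
    Const int
  | IVar 'b
  | SAdd "'b sexp" "'b sexp"
  | SSub "'b sexp" "'b sexp"
  | SMul "'b sexp" "'b sexp"

primrec seval :: "('b \<Rightarrow> int) \<Rightarrow> 'b sexp \<Rightarrow> int" where
  "seval \<rho> (Const n) = n"
| "seval \<rho> (IVar b) = \<rho> b"
| "seval \<rho> (SAdd e f) = seval \<rho> e + seval \<rho> f"
| "seval \<rho> (SSub e f) = seval \<rho> e - seval \<rho> f"
| "seval \<rho> (SMul e f) = seval \<rho> e * seval \<rho> f"

definition closed_sexp :: "'b sexp \<Rightarrow> bool" where
  "closed_sexp e \<longleftrightarrow> svars e = {}"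

text \<open>The value of a closed static expression; the environment is irrelevant for those.\<close>
definition sval :: "'b sexp \<Rightarrow> int" where
  "sval e = seval (\<lambda>_. 0) e"

datatype 'd depref = DName name | DVar 'd

datatype (atom_parts: 'p, atom_secrets: 's, atom_depvars: 'd) patom =
    Dep 'p rat "'d depref"
  | Sec 'p 's

text \<open>
  Preconditions, sums and split branches are taken modulo reordering, hence multisets.
  The sort of static expressions is a type parameter of contracts, so that the generated set and
  map functions collect, respectively rename or evaluate, the participants, the secrets, the
  static expressions and the recursion variables of a contract.
\<close>

datatype ('s, 'e) pexp =
    PStatic 'e
  | PSecret 's
  | PAdd "('s, 'e) pexp" "('s, 'e) pexp"
  | PSub "('s, 'e) pexp" "('s, 'e) pexp"

datatype (pred_secrets: 's, pred_sexps: 'e) pred =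
    PTrue
  | PAnd "('s, 'e) pred" "('s, 'e) pred"
  | PNot "('s, 'e) pred"
  | PEq "('s, 'e) pexp" "('s, 'e) pexp"
  | PLess "('s, 'e) pexp" "('s, 'e) pexp"

text \<open>
  The term \<open>Guarded Ps es D\<close> stands for \<open>P\<^sub>1: \<dots> P\<^sub>k: after e\<^sub>1: \<dots> after e\<^sub>m: D\<close>, where \<open>D\<close> carries
  no decoration: the order of decorations is immaterial.
  The contract \<open>Rngt X es\<close> is the starred renegotiation \<open>*:rngt X\<langle>es\<rangle>\<close>.
\<close>
datatype (ctr_parts: 'p, ctr_secrets: 's, ctr_sexps: 'e, ctr_rvars: 'x) contract =
    Choice "('p, 's, 'e, 'x) guarded multiset"
and (grd_parts: 'p, grd_secrets: 's, grd_sexps: 'e, grd_rvars: 'x) guarded =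
    Guarded "'p multiset" "'e multiset" "('p, 's, 'e, 'x) action"
and (act_parts: 'p, act_secrets: 's, act_sexps: 'e, act_rvars: 'x) action =
    Withdraw 'p
  | Reveal "'s list" "('s, 'e) pred" "('p, 's, 'e, 'x) contract"
  | Split "(rat \<times> ('p, 's, 'e, 'x) contract) multiset"
  | Rngt 'x "'e list"

type_synonym 'p precond = "('p, secret, depvar) patom multiset"
type_synonym ('p, 'x) ctr = "('p, secret, intvar sexp, 'x) contract"
type_synonym ('p, 'x) grd = "('p, secret, intvar sexp, 'x) guarded"

primrec pexp_eval :: "(secret \<Rightarrow> nat) \<Rightarrow> (secret, intvar sexp) pexp \<Rightarrow> int" where
  "pexp_eval N (PStatic e) = sval e"
| "pexp_eval N (PSecret a) = int (N a)"
| "pexp_eval N (PAdd e f) = pexp_eval N e + pexp_eval N f"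
| "pexp_eval N (PSub e f) = pexp_eval N e - pexp_eval N f"

primrec pred_holds :: "(secret \<Rightarrow> nat) \<Rightarrow> (secret, intvar sexp) pred \<Rightarrow> bool" where
  "pred_holds N PTrue \<longleftrightarrow> True"
| "pred_holds N (PAnd p q) \<longleftrightarrow> pred_holds N p \<and> pred_holds N q"
| "pred_holds N (PNot p) \<longleftrightarrow> \<not> pred_holds N p"
| "pred_holds N (PEq e f) \<longleftrightarrow> pexp_eval N e = pexp_eval N f"
| "pred_holds N (PLess e f) \<longleftrightarrow> pexp_eval N e < pexp_eval N f"

text \<open>The function \<open>ar\<close> gives the number of arguments of each recursion variable.\<close>
inductive wf_contract :: "('x \<Rightarrow> nat) \<Rightarrow> ('p, 'x) ctr \<Rightarrow> bool"
  and wf_guarded :: "('x \<Rightarrow> nat) \<Rightarrow> ('p, 'x) grd \<Rightarrow> bool"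
  and wf_action :: "('x \<Rightarrow> nat) \<Rightarrow> ('p, secret, intvar sexp, 'x) action \<Rightarrow> bool"
  for ar :: "'x \<Rightarrow> nat"
where
  "(\<forall>D \<in># Ds. wf_guarded ar D) \<Longrightarrow> wf_contract ar (Choice Ds)"
| "wf_action ar D \<Longrightarrow> wf_guarded ar (Guarded Ps es D)"
| "wf_action ar (Withdraw P)"
| "distinct as \<Longrightarrow> pred_secrets p \<subseteq> set as \<Longrightarrow> wf_contract ar C \<Longrightarrow> wf_action ar (Reveal as p C)"
| "(\<forall>b \<in># M. 0 \<le> fst b \<and> wf_contract ar (snd b)) \<Longrightarrow> wf_action ar (Split M)"
| "length es = ar X \<Longrightarrow> wf_action ar (Rngt X es)"

definition pre_parts :: "'p precond \<Rightarrow> 'p set" where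
  "pre_parts G = (\<Union>g \<in> set_mset G. atom_parts g)"

definition pre_secrets :: "'p precond \<Rightarrow> secret set" where
  "pre_secrets G = (\<Union>g \<in> set_mset G. atom_secrets g)"

definition pre_depvars :: "'p precond \<Rightarrow> depvar set" where
  "pre_depvars G = (\<Union>g \<in> set_mset G. atom_depvars g)"

definition pre_names :: "'p precond \<Rightarrow> name set" where
  "pre_names G = {x. \<exists>P v. Dep P v (DName x) \<in># G}"

definition wf_pre :: "('p \<Rightarrow> secret set) \<Rightarrow> 'p precond \<Rightarrow> bool" where
  "wf_pre S G \<longleftrightarrow>
     G \<noteq> {#} \<and>
     (\<forall>P v \<chi>. Dep P v \<chi> \<in># G \<longrightarrow> 0 \<le> v) \<and>
     (\<forall>P a. Sec P a \<in># G \<longrightarrow> a \<in> S P) \<and>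
     (\<forall>\<chi>. size {#g \<in># G. \<exists>P v. g = Dep P v \<chi>#} \<le> 1)"

text \<open>\<open>Adv G None C\<close> is \<open>{G}C\<close>, and \<open>Adv G (Some x) C\<close> is \<open>{G}\<close> \<open>C\<close> with superscript \<open>x\<close>.\<close>
datatype ('p, 'x) adv = Adv "'p precond" "name option" "('p, 'x) ctr"

text \<open>The constructors follow the order of the grammar of \<open>\<xi>\<close>.\<close>
datatype ('p, 'x) auth =
    AuCommit "('p, 'x) adv"
  | AuInit name "('p, 'x) adv"
  | AuBranch name "('p, 'x) grd"
  | AuJoin name name 'p rat
  | AuDivide name 'p rat 'p rat
  | AuDonate name 'p
  | AuDestroy "name list" nat name

text \<open>In \<open>TCommit P a N\<close>, the value \<open>None\<close> is \<open>\<bottom>\<close>.\<close>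
datatype ('p, 'x) cterm =
    TAdv "('p, 'x) adv"
  | TActive "('p, 'x) ctr" rat name
  | TDep 'p rat name
  | TAuth 'p "('p, 'x) auth"
  | TCommit 'p secret "nat option"
  | TReveal 'p secret nat
  | TBind 'p depvar name
  | TTime int

type_synonym ('p, 'x) config = "('p, 'x) cterm multiset"

definition cn :: "('p, 'x) config \<Rightarrow> name set" where
  "cn \<Gamma> = {x. \<exists>C v. TActive C v x \<in># \<Gamma>}"

definition timed :: "('p, 'x) config \<Rightarrow> bool" where
  "timed \<Gamma> \<longleftrightarrow> (\<exists>t. TTime t \<in># \<Gamma>)"

subsection \<open>Names, secrets and deposit variables in use\<close>

primrec adv_names :: "('p, 'x) adv \<Rightarrow> name set" where
  "adv_names (Adv G o' C) = pre_names G \<union> set_option o'"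

primrec adv_secrets :: "('p, 'x) adv \<Rightarrow> secret set" where
  "adv_secrets (Adv G o' C) = pre_secrets G \<union> ctr_secrets C"

primrec adv_depvars :: "('p, 'x) adv \<Rightarrow> depvar set" where
  "adv_depvars (Adv G o' C) = pre_depvars G"

primrec auth_names :: "('p, 'x) auth \<Rightarrow> name set" where
  "auth_names (AuCommit a) = adv_names a"
| "auth_names (AuInit x a) = insert x (adv_names a)"
| "auth_names (AuBranch x D) = {x}"
| "auth_names (AuJoin x y P v) = {x, y}"
| "auth_names (AuDivide x P v P' v') = {x}"
| "auth_names (AuDonate x Q) = {x}"
| "auth_names (AuDestroy xs j y) = insert y (set xs)"

primrec auth_secrets :: "('p, 'x) auth \<Rightarrow> secret set" where
  "auth_secrets (AuCommit a) = adv_secrets a"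
| "auth_secrets (AuInit x a) = adv_secrets a"
| "auth_secrets (AuBranch x D) = grd_secrets D"
| "auth_secrets (AuJoin x y P v) = {}"
| "auth_secrets (AuDivide x P v P' v') = {}"
| "auth_secrets (AuDonate x Q) = {}"
| "auth_secrets (AuDestroy xs j y) = {}"

primrec auth_depvars :: "('p, 'x) auth \<Rightarrow> depvar set" where
  "auth_depvars (AuCommit a) = adv_depvars a"
| "auth_depvars (AuInit x a) = adv_depvars a"
| "auth_depvars (AuBranch x D) = {}"
| "auth_depvars (AuJoin x y P v) = {}"
| "auth_depvars (AuDivide x P v P' v') = {}"
| "auth_depvars (AuDonate x Q) = {}"
| "auth_depvars (AuDestroy xs j y) = {}"

primrec cterm_names :: "('p, 'x) cterm \<Rightarrow> name set" where
  "cterm_names (TAdv a) = adv_names a"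
| "cterm_names (TActive C v x) = {x}"
| "cterm_names (TDep P v x) = {x}"
| "cterm_names (TAuth P \<xi>) = auth_names \<xi>"
| "cterm_names (TCommit P a N) = {}"
| "cterm_names (TReveal P a N) = {}"
| "cterm_names (TBind P d x) = {x}"
| "cterm_names (TTime t) = {}"

primrec cterm_secrets :: "('p, 'x) cterm \<Rightarrow> secret set" where
  "cterm_secrets (TAdv a) = adv_secrets a"
| "cterm_secrets (TActive C v x) = ctr_secrets C"
| "cterm_secrets (TDep P v x) = {}"
| "cterm_secrets (TAuth P \<xi>) = auth_secrets \<xi>"
| "cterm_secrets (TCommit P a N) = {a}"
| "cterm_secrets (TReveal P a N) = {a}"
| "cterm_secrets (TBind P d x) = {}"
| "cterm_secrets (TTime t) = {}"

primrec cterm_depvars :: "('p, 'x) cterm \<Rightarrow> depvar set" where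
  "cterm_depvars (TAdv a) = adv_depvars a"
| "cterm_depvars (TActive C v x) = {}"
| "cterm_depvars (TDep P v x) = {}"
| "cterm_depvars (TAuth P \<xi>) = auth_depvars \<xi>"
| "cterm_depvars (TCommit P a N) = {}"
| "cterm_depvars (TReveal P a N) = {}"
| "cterm_depvars (TBind P d x) = {d}"
| "cterm_depvars (TTime t) = {}"

definition names :: "('p, 'x) config \<Rightarrow> name set" where
  "names \<Gamma> = (\<Union>T \<in> set_mset \<Gamma>. cterm_names T)"

definition secrets :: "('p, 'x) config \<Rightarrow> secret set" where
  "secrets \<Gamma> = (\<Union>T \<in> set_mset \<Gamma>. cterm_secrets T)"

definition depvars :: "('p, 'x) config \<Rightarrow> depvar set" where
  "depvars \<Gamma> = (\<Union>T \<in> set_mset \<Gamma>. cterm_depvars T)"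

fun is_destroy_auth :: "name list \<Rightarrow> ('p, 'x) cterm \<Rightarrow> bool" where
  "is_destroy_auth xs (TAuth P (AuDestroy ys j y)) \<longleftrightarrow> ys = xs"
| "is_destroy_auth xs _ \<longleftrightarrow> False"

section \<open>Runs, origin and liquidity\<close>

datatype ('c, 'l) run = Start 'c | Extend "('c, 'l) run" 'l 'c

primrec run_first :: "('c, 'l) run \<Rightarrow> 'c" where
  "run_first (Start \<Gamma>) = \<Gamma>"
| "run_first (Extend R l \<Gamma>) = run_first R"

primrec run_last :: "('c, 'l) run \<Rightarrow> 'c" where
  "run_last (Start \<Gamma>) = \<Gamma>"
| "run_last (Extend R l \<Gamma>) = \<Gamma>"

primrec run_labels :: "('c, 'l) run \<Rightarrow> 'l set" where
  "run_labels (Start \<Gamma>) = {}"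
| "run_labels (Extend R l \<Gamma>) = insert l (run_labels R)"

primrec is_run :: "('c \<Rightarrow> 'l \<Rightarrow> 'c \<Rightarrow> bool) \<Rightarrow> ('c, 'l) run \<Rightarrow> bool" where
  "is_run step (Start \<Gamma>) \<longleftrightarrow> True"
| "is_run step (Extend R l \<Gamma>) \<longleftrightarrow> is_run step R \<and> step (run_last R) l \<Gamma>"

text \<open>In the following, \<open>cns\<close> gives the contract names of a configuration.\<close>

primrec orig :: "('c \<Rightarrow> name set) \<Rightarrow> ('c, 'l) run \<Rightarrow> name \<Rightarrow> name option" where
  "orig cns (Start \<Gamma>) x = (if x \<in> cns \<Gamma> then Some x else None)"
| "orig cns (Extend R l \<Gamma>) x =
     (if x \<in> cns (run_last R) \<inter> cns \<Gamma> then orig cns R x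
      else if x \<in> cns \<Gamma> - cns (run_last R) \<and> (\<exists>y. {y} = cns (run_last R) - cns \<Gamma>)
      then orig cns R (THE y. {y} = cns (run_last R) - cns \<Gamma>)
      else None)"

definition liquidable ::
  "('c \<Rightarrow> 'l \<Rightarrow> 'c \<Rightarrow> bool) \<Rightarrow> ('c \<Rightarrow> name set) \<Rightarrow> 'l set \<Rightarrow> 'c \<Rightarrow> name \<Rightarrow> bool" where
  "liquidable step cns L \<Gamma> x \<longleftrightarrow>
     (\<exists>R. is_run step R \<and> run_first R = \<Gamma> \<and> run_labels R \<subseteq> L \<and>
          \<not> (\<exists>z \<in> cns (run_last R). orig cns R z = Some x))"

definition liquid ::
  "('c \<Rightarrow> 'l \<Rightarrow> 'c \<Rightarrow> bool) \<Rightarrow> ('c \<Rightarrow> name set) \<Rightarrow> 'l set \<Rightarrow> 'c \<Rightarrow> name \<Rightarrow> bool" where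
  "liquid step cns L \<Gamma> x \<longleftrightarrow>
     (\<forall>R. is_run step R \<and> run_first R = \<Gamma> \<longrightarrow>
          (\<forall>y. orig cns R y = Some x \<longrightarrow> liquidable step cns L (run_last R) y))"

section \<open>Labels of the concrete semantics\<close>

text \<open>The label \<open>P:\<dots>\<close> is \<open>By P \<dots>\<close>, with the following possibilities for what comes after the colon.\<close>
datatype ('p, 'x) plabel =
    PJoin name name
  | PDivide name rat rat
  | PDonate name 'p
  | PDestroy "name list" nat
  | PCommit "('p, 'x) adv" "('p, 'x) config"
  | PInit "('p, 'x) adv" name
  | PReveal secret
  | PBranch name "('p, 'x) grd"

datatype ('p, 'x) label =
    By 'p "('p, 'x) plabel"
  | Join name name
  | Divide name rat rat
  | Donate name 'p
  | Destroy "name list"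
  | Advertise "('p, 'x) adv"
  | Initiate "'p precond" "('p, 'x) ctr"
  | DoWithdraw 'p rat name
  | DoSplit name
  | DoReveal "secret list" name
  | Delay int
  | AdvRngt "('p, 'x) adv"
  | DoRngt name "'p precond" "('p, 'x) ctr"

definition clabels :: "'p \<Rightarrow> ('p, 'x) label set" where
  "clabels A = {l. \<forall>P k. l = By P k \<longrightarrow> P = A}"

section \<open>Abstract contracts\<close>

datatype ('p, 'x) acontract =
    AChoice "('p, 'x) aguarded multiset"
and ('p, 'x) aguarded =
    AWithdraw 'p
  | ATau "('p, 'x) acontract"
  | ASplit "('p, 'x) acontract multiset"
  | AStar "('p, 'x) aguarded"
  | ARngt 'x

text \<open>Prefixing with a star, modulo the identification of \<open>*:*:D\<close> with \<open>*:D\<close>.\<close>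
definition astar :: "('p, 'x) aguarded \<Rightarrow> ('p, 'x) aguarded" where
  "astar D = (case D of AStar D' \<Rightarrow> D | _ \<Rightarrow> AStar D)"

text \<open>
  Each decoration by a participant other than \<open>A\<close> contributes a star, and one star is the same as
  many, so only the presence of such a decoration matters.
\<close>
primrec abs_contract :: "('p \<Rightarrow> secret set) \<Rightarrow> 'p \<Rightarrow> ('p, 'x) ctr \<Rightarrow> ('p, 'x) acontract"
  and abs_guarded :: "('p \<Rightarrow> secret set) \<Rightarrow> 'p \<Rightarrow> ('p, 'x) grd \<Rightarrow> ('p, 'x) aguarded"
  and abs_action ::
    "('p \<Rightarrow> secret set) \<Rightarrow> 'p \<Rightarrow> ('p, secret, intvar sexp, 'x) action \<Rightarrow> ('p, 'x) aguarded"
where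
  "abs_contract S A (Choice Ds) = AChoice (image_mset (abs_guarded S A) Ds)"
| "abs_guarded S A (Guarded Ps es D) =
     (if \<forall>P \<in># Ps. P = A then abs_action S A D else astar (abs_action S A D))"
| "abs_action S A (Withdraw P) = AWithdraw P"
| "abs_action S A (Reveal as p C) =
     (if p = PTrue \<and> set as \<subseteq> S A then ATau (abs_contract S A C)
      else AStar (ATau (abs_contract S A C)))"
| "abs_action S A (Split M) = ASplit (image_mset snd (image_mset (map_prod id (abs_contract S A)) M))"
| "abs_action S A (Rngt X es) = AStar (ARngt X)"

datatype ('p, 'x) aterm =
    AActive "('p, 'x) acontract" name
  | ARec 'x

type_synonym ('p, 'x) aconfig = "('p, 'x) aterm multiset"

definition acn :: "('p, 'x) aconfig \<Rightarrow> name set" where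
  "acn \<Gamma> = {x. \<exists>C. AActive C x \<in># \<Gamma>}"

fun abs_cterm :: "('p \<Rightarrow> secret set) \<Rightarrow> 'p \<Rightarrow> name set \<Rightarrow> ('p, 'x) cterm \<Rightarrow> ('p, 'x) aconfig" where
  "abs_cterm S A \<X> (TActive C v x) = (if x \<in> \<X> then {#AActive (abs_contract S A C) x#} else {#})"
| "abs_cterm S A \<X> _ = {#}"

definition abs_config :: "('p \<Rightarrow> secret set) \<Rightarrow> 'p \<Rightarrow> name set \<Rightarrow> ('p, 'x) config \<Rightarrow> ('p, 'x) aconfig" where
  "abs_config S A \<X> \<Gamma> = (\<Sum>T \<in># \<Gamma>. abs_cterm S A \<X> T)"

text \<open>\<open>ALab False x\<close> is the label \<open>x\<close>, and \<open>ALab True x\<close> is \<open>*:x\<close>.\<close>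
datatype alabel = ALab bool (alab_name: name)

definition alab_star :: "alabel \<Rightarrow> alabel" where
  "alab_star l = ALab True (alab_name l)"

definition alabels :: "alabel set" where
  "alabels = range (ALab False)"

section \<open>Semantics\<close>

text \<open>
  The equation of \<open>X\<close> is \<open>X(params X) = {pre X} body X\<close>, and \<open>S P\<close> is the set of secret names
  usable by \<open>P\<close>.
\<close>
locale bitml =
  fixes Hon :: "'p set"
    and S :: "'p \<Rightarrow> secret set"
    and params :: "'x::finite \<Rightarrow> intvar list"
    and pre :: "'x \<Rightarrow> 'p precond"
    and body :: "'x \<Rightarrow> ('p, 'x) ctr"
  assumes S_disjoint: "P \<noteq> Q \<Longrightarrow> S P \<inter> S Q = {}"
    and params_distinct: "distinct (params X)"
    and pre_wf: "wf_pre S (pre X)"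
    and body_wf: "wf_contract (\<lambda>Y. length (params Y)) (body X)"
    and body_vars: "e \<in> ctr_sexps (body X) \<Longrightarrow> svars e \<subseteq> set (params X)"
begin

abbreviation arity :: "'x \<Rightarrow> nat" where
  "arity X \<equiv> length (params X)"

primrec wf_adv :: "('p, 'x) adv \<Rightarrow> bool" where
  "wf_adv (Adv G o' C) \<longleftrightarrow>
     wf_pre S G \<and> wf_contract arity C \<and>
     (\<forall>e \<in> ctr_sexps C. closed_sexp e) \<and>
     ctr_secrets C \<subseteq> pre_secrets G \<and>
     (\<forall>P \<in> pre_parts G \<union> ctr_parts C. \<exists>v \<chi>. Dep P v \<chi> \<in># G) \<and>
     (\<forall>X \<in> ctr_rvars C. pre_parts (pre X) = pre_parts G)"

primrec wf_auth :: "('p, 'x) auth \<Rightarrow> bool" where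
  "wf_auth (AuCommit a) \<longleftrightarrow> wf_adv a"
| "wf_auth (AuInit x a) \<longleftrightarrow> wf_adv a"
| "wf_auth (AuBranch x D) \<longleftrightarrow> wf_guarded arity D"
| "wf_auth (AuJoin x y P v) \<longleftrightarrow> 0 \<le> v"
| "wf_auth (AuDivide x P v P' v') \<longleftrightarrow> P' = P \<and> 0 \<le> v \<and> 0 \<le> v'"
| "wf_auth (AuDonate x Q) \<longleftrightarrow> True"
| "wf_auth (AuDestroy xs j y) \<longleftrightarrow> True"

primrec wf_cterm :: "('p, 'x) cterm \<Rightarrow> bool" where
  "wf_cterm (TAdv a) \<longleftrightarrow> wf_adv a"
| "wf_cterm (TActive C v x) \<longleftrightarrow> wf_contract arity C \<and> 0 \<le> v"
| "wf_cterm (TDep P v x) \<longleftrightarrow> 0 \<le> v"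
| "wf_cterm (TAuth P \<xi>) \<longleftrightarrow> wf_auth \<xi>"
| "wf_cterm (TCommit P a N) \<longleftrightarrow> True"
| "wf_cterm (TReveal P a N) \<longleftrightarrow> True"
| "wf_cterm (TBind P d x) \<longleftrightarrow> True"
| "wf_cterm (TTime t) \<longleftrightarrow> True"

definition wf_config :: "('p, 'x) config \<Rightarrow> bool" where
  "wf_config \<Gamma> \<longleftrightarrow>
     (\<forall>T \<in># \<Gamma>. wf_cterm T) \<and>
     (\<forall>P \<xi>. count \<Gamma> (TAuth P \<xi>) \<le> 1) \<and>
     (\<forall>x. size {#T \<in># \<Gamma>. (\<exists>C v. T = TActive C v x) \<or> (\<exists>P v. T = TDep P v x)#} \<le> 1) \<and>
     size {#T \<in># \<Gamma>. \<exists>t. T = TTime t#} \<le> 1"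

definition initial :: "('p, 'x) config \<Rightarrow> bool" where
  "initial \<Gamma> \<longleftrightarrow>
     wf_config \<Gamma> \<and> timed \<Gamma> \<and>
     (\<forall>T \<in># \<Gamma>. (\<exists>P v x. T = TDep P v x) \<or> (\<exists>t. T = TTime t))"

text \<open>
  The relation \<open>{G}C \<equiv> X\<langle>es\<rangle>\<close>. The renamings are applied to all occurrences; that they map the
  secrets of a participant to secrets of the same participant follows from well-formedness of \<open>G\<close>.
\<close>
definition instance_of :: "'p precond \<Rightarrow> ('p, 'x) ctr \<Rightarrow> 'x \<Rightarrow> intvar sexp list \<Rightarrow> bool" where
  "instance_of G C X es \<longleftrightarrow>
     length es = arity X \<and> (\<forall>e \<in> set es. closed_sexp e) \<and>
     (\<exists>\<sigma> \<theta>. bij \<sigma> \<and> bij \<theta> \<and>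
        G = image_mset (map_patom id \<sigma> \<theta>) (pre X) \<and>
        C = map_contract id \<sigma>
              (\<lambda>e. Const (seval (\<lambda>\<beta>. the (map_of (zip (params X) (map sval es)) \<beta>)) e)) id (body X))"

text \<open>
  The part of \<open>\<Delta>\<close> contributed by an atom of \<open>G\<close>, respectively by the whole of \<open>G\<close>, when the
  deposit variable \<open>d\<close> is bound to \<open>f d\<close>. This is without the authorizations for the
  renegotiated contract.
\<close>
fun stipulated_atom ::
  "('p, 'x) adv \<Rightarrow> (depvar \<Rightarrow> name) \<Rightarrow> ('p, secret, depvar) patom \<Rightarrow> ('p, 'x) config" where
  "stipulated_atom a f (Dep P v (DName x)) = {#TDep P v x, TAuth P (AuInit x a)#}"
| "stipulated_atom a f (Dep P v (DVar d)) =
     {#TDep P v (f d), TBind P d (f d), TAuth P (AuInit (f d) a)#}"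
| "stipulated_atom a f (Sec P s) = {#}"

definition stipulated :: "'p precond \<Rightarrow> ('p, 'x) adv \<Rightarrow> (depvar \<Rightarrow> name) \<Rightarrow> ('p, 'x) config" where
  "stipulated G a f =
     (\<Sum>g \<in># G. stipulated_atom a f g) + {#TAuth P (AuCommit a). P \<in># mset_set (pre_parts G)#}"

fun atom_value :: "('p, secret, depvar) patom \<Rightarrow> rat" where
  "atom_value (Dep P v \<chi>) = v"
| "atom_value (Sec P s) = 0"

definition pre_value :: "'p precond \<Rightarrow> rat" where
  "pre_value G = (\<Sum>g \<in># G. atom_value g)"

text \<open>
  The rules, on configurations that need not be timed: the premise of \<open>Branch\<close> is about the
  configuration without its time term. Freshness refers to the whole source configuration.

  In \<open>Branch\<close>, one authorization is consumed for each \<^emph>\<open>distinct\<close> participant decorating the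
  branch, as configurations do not contain duplicate authorizations. In \<open>SplitC\<close>, if all the
  weights are 0 then all the resulting contracts have value 0.
\<close>
inductive rule :: "('p, 'x) config \<Rightarrow> ('p, 'x) label \<Rightarrow> ('p, 'x) config \<Rightarrow> bool" where
  AuthJoin:
    "\<Gamma>0 = {#TDep P v x, TDep P v' y#} + \<Gamma> \<Longrightarrow>
     rule \<Gamma>0 (By P (PJoin x y)) (add_mset (TAuth P (AuJoin x y P (v + v'))) \<Gamma>0)"
| DepJoin:
    "\<Gamma>0 = {#TDep P v x, TDep P v' y,
            TAuth P (AuJoin x y P (v + v')), TAuth P (AuJoin y x P (v + v'))#} + \<Gamma> \<Longrightarrow>
     z \<notin> names \<Gamma>0 \<Longrightarrow>
     rule \<Gamma>0 (Join x y) (add_mset (TDep P (v + v') z) \<Gamma>)"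
| AuthDivide:
    "\<Gamma>0 = add_mset (TDep P (v + v') x) \<Gamma> \<Longrightarrow>
     rule \<Gamma>0 (By P (PDivide x v v')) (add_mset (TAuth P (AuDivide x P v P v')) \<Gamma>0)"
| DepDivide:
    "\<Gamma>0 = {#TDep P (v + v') x, TAuth P (AuDivide x P v P v')#} + \<Gamma> \<Longrightarrow>
     y \<notin> names \<Gamma>0 \<Longrightarrow> y' \<notin> names \<Gamma>0 \<Longrightarrow> y \<noteq> y' \<Longrightarrow>
     rule \<Gamma>0 (Divide x v v') ({#TDep P v y, TDep P v' y'#} + \<Gamma>)"
| AuthDonate:
    "\<Gamma>0 = add_mset (TDep P v x) \<Gamma> \<Longrightarrow>
     rule \<Gamma>0 (By P (PDonate x Q)) (add_mset (TAuth P (AuDonate x Q)) \<Gamma>0)"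
| DepDonate:
    "\<Gamma>0 = {#TDep P v x, TAuth P (AuDonate x Q)#} + \<Gamma> \<Longrightarrow>
     y \<notin> names \<Gamma>0 \<Longrightarrow>
     rule \<Gamma>0 (Donate x Q) (add_mset (TDep Q v y) \<Gamma>)"
| AuthDestroy:
    "\<Gamma>0 = mset (map (\<lambda>(P, v, x). TDep P v x) ds) + \<Gamma> \<Longrightarrow>
     xs = map (\<lambda>(P, v, x). x) ds \<Longrightarrow>
     j < length ds \<Longrightarrow> P = fst (ds ! j) \<Longrightarrow>
     y \<notin> names {#T \<in># \<Gamma>0. \<not> is_destroy_auth xs T#} \<Longrightarrow>
     rule \<Gamma>0 (By P (PDestroy xs j)) (add_mset (TAuth P (AuDestroy xs j y)) \<Gamma>0)"
| DepDestroy: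
    "xs = map (\<lambda>(P, v, x). x) ds \<Longrightarrow>
     rule (mset (map (\<lambda>(P, v, x). TDep P v x) ds)
           + mset (map (\<lambda>j. TAuth (fst (ds ! j)) (AuDestroy xs j y)) [0..<length ds]) + \<Gamma>)
       (Destroy xs) \<Gamma>"
| AdvC:
    "(\<And>P v x. Dep P v (DName x) \<in># G \<Longrightarrow> TDep P v x \<in># \<Gamma>) \<Longrightarrow>
     pre_secrets G \<inter> secrets \<Gamma> = {} \<Longrightarrow>
     rule \<Gamma> (Advertise (Adv G None C)) (add_mset (TAdv (Adv G None C)) \<Gamma>)"
| AuthCommit:
    "\<Gamma>0 = add_mset (TAdv a) \<Gamma> \<Longrightarrow> a = Adv G o' C \<Longrightarrow>
     distinct as \<Longrightarrow> set as = {s. Sec P s \<in># G} \<Longrightarrow> length Ns = length as \<Longrightarrow>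
     (\<And>s. s \<in> set as \<Longrightarrow> (\<forall>N. TCommit P s N \<notin># \<Gamma>) \<and> (\<forall>N. TReveal P s N \<notin># \<Gamma>)) \<Longrightarrow>
     (P \<in> Hon \<Longrightarrow> None \<notin> set Ns) \<Longrightarrow>
     distinct ds \<Longrightarrow> set ds = {d. \<exists>v. Dep P v (DVar d) \<in># G} \<Longrightarrow> length xs = length ds \<Longrightarrow>
     (\<And>i. i < length ds \<Longrightarrow>
        (\<forall>x. TBind P (ds ! i) x \<notin># \<Gamma>) \<and>
        (\<exists>v. Dep P v (DVar (ds ! i)) \<in># G \<and> TDep P v (xs ! i) \<in># \<Gamma>)) \<Longrightarrow>
     distinct xs \<Longrightarrow> (\<And>v x. Dep P v (DName x) \<in># G \<Longrightarrow> x \<notin> set xs) \<Longrightarrow>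
     \<Delta> = mset (map2 (TCommit P) as Ns) + mset (map2 (TBind P) ds xs) \<Longrightarrow>
     rule \<Gamma>0 (By P (PCommit a \<Delta>)) (add_mset (TAuth P (AuCommit a)) (\<Delta> + \<Gamma>0))"
| AuthInitDep:
    "\<Gamma>0 = add_mset (TAdv a) \<Gamma> \<Longrightarrow> a = Adv G o' C \<Longrightarrow>
     (\<And>Q. Q \<in> pre_parts G \<Longrightarrow> TAuth Q (AuCommit a) \<in># \<Gamma>) \<Longrightarrow>
     (\<exists>v. Dep P v (DName x) \<in># G) \<or>
     (\<exists>v d. Dep P v (DVar d) \<in># G \<and> TBind P d x \<in># \<Gamma>) \<or>
     (o' = Some x \<and> P \<in> pre_parts G) \<Longrightarrow>
     rule \<Gamma>0 (By P (PInit a x)) (add_mset (TAuth P (AuInit x a)) \<Gamma>0)"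
| InitC:
    "a = Adv G None C \<Longrightarrow>
     \<Gamma>0 = add_mset (TAdv a) (stipulated G a f + \<Gamma>) \<Longrightarrow>
     z \<notin> names \<Gamma>0 \<Longrightarrow>
     rule \<Gamma>0 (Initiate G C) (add_mset (TActive C (pre_value G) z) \<Gamma>)"
| WithdrawC:
    "\<Gamma>0 = add_mset (TActive (Choice {#Guarded {#} {#} (Withdraw P)#}) v x) \<Gamma> \<Longrightarrow>
     y \<notin> names \<Gamma>0 \<Longrightarrow>
     rule \<Gamma>0 (DoWithdraw P v x) (add_mset (TDep P v y) \<Gamma>)"
| SplitC:
    "\<Gamma>0 = add_mset (TActive (Choice {#Guarded {#} {#} (Split (mset bs))#}) v x) \<Gamma> \<Longrightarrow>
     w = sum_list (map fst bs) \<Longrightarrow>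
     length ys = length bs \<Longrightarrow> distinct ys \<Longrightarrow> set ys \<inter> names \<Gamma>0 = {} \<Longrightarrow>
     rule \<Gamma>0 (DoSplit x) (mset (map2 (\<lambda>(w', C) y. TActive C (v * w' / w) y) bs ys) + \<Gamma>)"
| AuthRev:
    "rule (add_mset (TCommit P s (Some N)) \<Gamma>) (By P (PReveal s)) (add_mset (TReveal P s N) \<Gamma>)"
| RevC:
    "\<Delta> = mset (map (\<lambda>s. TReveal (Q s) s (N s)) as) \<Longrightarrow>
     \<Gamma>0 = add_mset (TActive (Choice {#Guarded {#} {#} (Reveal as p C)#}) v x) (\<Delta> + \<Gamma>) \<Longrightarrow>
     pred_holds N p \<Longrightarrow>
     y \<notin> names \<Gamma>0 \<Longrightarrow>
     rule \<Gamma>0 (DoReveal as y) (add_mset (TActive C v y) (\<Delta> + \<Gamma>))"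
| AuthBranch:
    "\<Gamma>0 = add_mset (TActive (Choice (add_mset D Ds)) v x) \<Gamma> \<Longrightarrow>
     D = Guarded Ps es D' \<Longrightarrow> P \<in># Ps \<Longrightarrow>
     rule \<Gamma>0 (By P (PBranch x D)) (add_mset (TAuth P (AuBranch x D)) \<Gamma>0)"
| Branch:
    "D = Guarded Ps es D' \<Longrightarrow>
     rule (add_mset (TActive (Choice {#Guarded {#} {#} D'#}) v x) \<Gamma>) l \<Gamma>' \<Longrightarrow>
     x \<notin> cn \<Gamma>' \<Longrightarrow>
     (\<And>e. e \<in># es \<Longrightarrow> closed_sexp e \<and> sval e \<le> t) \<Longrightarrow>
     rule (add_mset (TActive (Choice (add_mset D Ds)) v x)
            ({#TAuth P (AuBranch x D). P \<in># mset_set (set_mset Ps)#} + add_mset (TTime t) \<Gamma>))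
       l (add_mset (TTime t) \<Gamma>')"
| DelayC:
    "0 < \<delta> \<Longrightarrow> rule (add_mset (TTime t) \<Gamma>) (Delay \<delta>) (add_mset (TTime (t + \<delta>)) \<Gamma>)"
| AdvRngtC:
    "\<Gamma>0 = add_mset (TActive (Choice (add_mset (Guarded {#} {#} (Rngt X es)) Ds)) v x) \<Gamma> \<Longrightarrow>
     instance_of G C X es \<Longrightarrow>
     pre_secrets G \<inter> secrets \<Gamma>0 = {} \<Longrightarrow> pre_depvars G \<inter> depvars \<Gamma>0 = {} \<Longrightarrow>
     (\<And>G' C'. TAdv (Adv G' (Some x) C') \<in># \<Gamma> \<Longrightarrow> \<not> instance_of G' C' X es) \<Longrightarrow>
     (\<And>P u y. Dep P u (DName y) \<in># G \<Longrightarrow> TDep P u y \<in># \<Gamma>) \<Longrightarrow>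
     a = Adv G (Some x) C \<Longrightarrow>
     rule \<Gamma>0 (AdvRngt a) (add_mset (TAdv a) \<Gamma>0)"
| RngtC:
    "instance_of G C X es \<Longrightarrow>
     a = Adv G (Some x) C \<Longrightarrow>
     \<Gamma>0 = add_mset (TActive (Choice (add_mset (Guarded {#} {#} (Rngt X es)) Ds)) v x)
            (add_mset (TAdv a)
              (stipulated G a f + {#TAuth P (AuInit x a). P \<in># mset_set (pre_parts G)#} + \<Gamma>)) \<Longrightarrow>
     y \<notin> names \<Gamma>0 \<Longrightarrow>
     rule \<Gamma>0 (DoRngt x G C) (add_mset (TActive C (v + pre_value G) y) \<Gamma>)"

definition cstep :: "('p, 'x) config \<Rightarrow> ('p, 'x) label \<Rightarrow> ('p, 'x) config \<Rightarrow> bool" where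
  "cstep \<Gamma> l \<Gamma>' \<longleftrightarrow>
     wf_config \<Gamma> \<and> timed \<Gamma> \<and> wf_config \<Gamma>' \<and> timed \<Gamma>' \<and> rule \<Gamma> l \<Gamma>'"

definition reachable :: "('p, 'x) config \<Rightarrow> bool" where
  "reachable \<Gamma> \<longleftrightarrow> (\<exists>R. is_run cstep R \<and> initial (run_first R) \<and> run_last R = \<Gamma>)"

text \<open>The abstract equations are \<open>X = abs_contract S A (body X)\<close>.\<close>
inductive astep :: "'p \<Rightarrow> ('p, 'x) aconfig \<Rightarrow> alabel \<Rightarrow> ('p, 'x) aconfig \<Rightarrow> bool"
  for A :: 'p
where
  "astep A (add_mset (AActive (AChoice {#AWithdraw P#}) x) \<Gamma>) (ALab False x) \<Gamma>"
| "y \<notin> insert x (acn \<Gamma>) \<Longrightarrow>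
   astep A (add_mset (AActive (AChoice {#ATau C#}) x) \<Gamma>) (ALab False x) (add_mset (AActive C y) \<Gamma>)"
| "length ys = length Cs \<Longrightarrow> distinct ys \<Longrightarrow> set ys \<inter> insert x (acn \<Gamma>) = {} \<Longrightarrow>
   astep A (add_mset (AActive (AChoice {#ASplit (mset Cs)#}) x) \<Gamma>) (ALab False x)
     (mset (map2 AActive Cs ys) + \<Gamma>)"
| "astep A (add_mset (AActive (AChoice {#D#}) x) \<Gamma>) l \<Gamma>' \<Longrightarrow> x = alab_name l \<Longrightarrow>
   astep A (add_mset (AActive (AChoice (add_mset D Ds)) x) \<Gamma>) l \<Gamma>'"
| "astep A (add_mset (AActive (AChoice {#D#}) x) \<Gamma>) l \<Gamma>' \<Longrightarrow> x = alab_name l \<Longrightarrow>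
   astep A (add_mset (AActive (AChoice {#AStar D#}) x) \<Gamma>) (alab_star l) \<Gamma>'"
| "y \<notin> insert x (acn \<Gamma>) \<Longrightarrow>
   astep A (add_mset (AActive (AChoice {#AStar (ARngt X)#}) x) \<Gamma>) (ALab True x)
     (add_mset (AActive (abs_contract S A (body X)) y) (add_mset (ARec X) \<Gamma>))"

end

end

theory Submission
  imports Defs
begin

text \<open>
  Forgetting everything but the active contracts descending from \<open>\<X>\<close> turns a concrete run into an
  abstract one with the same origins: a concrete rule either adds fresh active contracts without
  consuming any, which the abstraction ignores, or consumes exactly one active contract, as in an
  abstract step. So a contract of origin \<open>x\<close> in the concrete run is abstractly liquidable.

  Conversely, an abstract run without stars that removes all descendants of a contract shows that the
  contract is \<open>killable\<close>, an inductive property of the abstract contract alone. This frees us from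
  matching the fresh names of the abstract run with those of a concrete one. A killable contract can be
  terminated concretely by \<open>A\<close> on her own: she reveals her secrets, which as an honest participant she
  has committed to properly, authorizes the branch, waits for the time constraints to expire, takes
  the branch, and goes on with the resulting contracts.
\<close>

section \<open>Runs\<close>

text \<open>Three obstacles shape the details. In an arbitrary configuration \<open>A\<close> need
  not be able to reveal her secrets, and an \<open>after\<close> decoration can be passed only if
  its expression is closed; well-formedness of an active contract guarantees neither. Both facts are
  carried from the initial configuration by the invariant \<open>consistent\<close>, and they
  originate in the advertisement that all parties committed to. Next, a renegotiated contract is an
  instance of an equation with renamed secrets, whereas the abstract equation abstracts the equation
  as it stands; the two agree because a renaming between well-formed preconditions keeps the owner
  of each secret. Finally, the two halves treat labels differently: liquidity quantifies over runs
  with any labels, so the simulation may leave open whether an abstract step is starred, while the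
  run that liquidates must consist of unstarred abstract steps, respectively of moves open to
  \<open>A\<close>.\<close>

primrec run_append :: "('c, 'l) run \<Rightarrow> ('c, 'l) run \<Rightarrow> ('c, 'l) run" where
  "run_append Q (Start \<Gamma>) = Q"
| "run_append Q (Extend R l \<Gamma>) = Extend (run_append Q R) l \<Gamma>"

lemma run_append_simps [simp]:
  "run_first (run_append Q R) = run_first Q"
  "run_labels (run_append Q R) = run_labels Q \<union> run_labels R"
  by (induction R) auto

lemma run_last_append [simp]: "run_last Q = run_first R \<Longrightarrow> run_last (run_append Q R) = run_last R"
  by (induction R) auto

lemma is_run_append [simp]:
  "run_last Q = run_first R \<Longrightarrow> is_run step (run_append Q R) \<longleftrightarrow> is_run step Q \<and> is_run step R"
  by (induction R) auto

lemma orig_new: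
  assumes "z \<in> cns \<Gamma>" "z \<notin> cns (run_last R)" "cns (run_last R) - cns \<Gamma> = {x}"
  shows "orig cns (Extend R l \<Gamma>) z = orig cns R x"
  using assms by auto

lemma orig_in_last: "orig cns R z = Some x \<Longrightarrow> z \<in> cns (run_last R)"
  by (cases R) (auto split: if_splits)

text \<open>A newly added name has no origin: nothing has disappeared, so there is no vanished name
  to inherit from.\<close>

lemma orig_activates:
  assumes "cns \<Gamma> = F \<union> cns (run_last R)"
  shows "orig cns (Extend R l \<Gamma>) z = orig cns R z"
  using assms orig_in_last[of cns R z] by (cases "orig cns R z") auto

text \<open>Serves concrete and abstract runs alike: both kinds of step consume a single name, so
  the same formula on both sides makes the origins match.\<close>

lemma orig_consumes:
  assumes "cns (run_last R) = insert x B" "x \<notin> B" "cns \<Gamma> = F \<union> B" "F \<inter> insert x B = {}"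
  shows "orig cns (Extend R l \<Gamma>) z =
    (if z \<in> F then orig cns R x else if z = x then None else orig cns R z)"
proof -
  have *: "cns (run_last R) - cns \<Gamma> = {x}" using assms by auto
  show ?thesis
  proof (cases "z \<in> F")
    case True
    then have "orig cns (Extend R l \<Gamma>) z = orig cns R x"
      using assms by (intro orig_new[OF _ _ *]) auto
    with True show ?thesis by simp
  next
    case False
    then show ?thesis using assms orig_in_last[of cns R z] by (cases "orig cns R z") auto
  qed
qed

text \<open>\<open>R\<close> starts where \<open>Q\<close> ends, so tracing back through the joined
  run composes two partial functions.\<close>

lemma orig_append:
  assumes "run_last Q = run_first R"
  shows "orig cns (run_append Q R) z = Option.bind (orig cns R z) (orig cns Q)"
  using assms
proof (induction R arbitrary: z)
  case (Start \<Gamma>)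
  then show ?case
    using orig_in_last[of cns Q z] by (cases "orig cns Q z") auto
next
  case (Extend R l \<Gamma>)
  then show ?case by auto
qed

section \<open>Multisets without duplicates\<close>

definition distinct_mset :: "'a multiset \<Rightarrow> bool" where
  "distinct_mset M \<longleftrightarrow> (\<forall>x. count M x \<le> 1)"

lemma distinct_mset_simps [simp]:
  "distinct_mset {#}"
  "distinct_mset (add_mset x M) \<longleftrightarrow> x \<notin># M \<and> distinct_mset M"
  by (auto simp: distinct_mset_def not_in_iff le_Suc_eq split: if_splits)

lemma distinct_mset_union:
  "distinct_mset (M + N) \<longleftrightarrow> distinct_mset M \<and> distinct_mset N \<and> set_mset M \<inter> set_mset N = {}"
  by (induction M) auto

lemma distinct_mset_mset [simp]: "distinct_mset (mset xs) \<longleftrightarrow> distinct xs"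
  by (induction xs) auto

lemma distinct_mset_mono: "M \<subseteq># N \<Longrightarrow> distinct_mset N \<Longrightarrow> distinct_mset M"
  unfolding distinct_mset_def by (meson le_trans mset_subset_eq_count)

text \<open>Lets terms that were shown to be present one by one be split off together, as matching
  the left-hand side of a rule requires.\<close>

lemma distinct_mset_subset:
  "distinct_mset M \<Longrightarrow> set_mset M \<subseteq> set_mset N \<Longrightarrow> M \<subseteq># N"
  unfolding distinct_mset_def subseteq_mset_def
  by (metis count_greater_eq_one_iff le_trans not_in_iff subsetD zero_le)

section \<open>Active contracts\<close>

text \<open>Balances are dropped, since neither the abstraction nor the origin depends on
  them.\<close>

primrec active_term :: "('p, 'x) cterm \<Rightarrow> (('p, 'x) ctr \<times> name) multiset" where
  "active_term (TAdv a) = {#}"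
| "active_term (TActive C v x) = {#(C, x)#}"
| "active_term (TDep P v x) = {#}"
| "active_term (TAuth P \<xi>) = {#}"
| "active_term (TCommit P a N) = {#}"
| "active_term (TReveal P a N) = {#}"
| "active_term (TBind P d x) = {#}"
| "active_term (TTime t) = {#}"

definition actives :: "('p, 'x) config \<Rightarrow> (('p, 'x) ctr \<times> name) multiset" where
  "actives \<Gamma> = (\<Sum>T \<in># \<Gamma>. active_term T)"

lemma actives_simps [simp]:
  "actives {#} = {#}"
  "actives (add_mset T \<Gamma>) = active_term T + actives \<Gamma>"
  "actives (\<Gamma> + \<Delta>) = actives \<Gamma> + actives \<Delta>"
  by (auto simp: actives_def)

lemma in_active_term: "(C, x) \<in># active_term T \<longleftrightarrow> (\<exists>v. T = TActive C v x)"
  by (cases T) auto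

lemma in_actives: "(C, x) \<in># actives \<Gamma> \<longleftrightarrow> (\<exists>v. TActive C v x \<in># \<Gamma>)"
  by (induction \<Gamma>) (auto simp: in_active_term)

lemma cn_actives: "cn \<Gamma> = snd ` set_mset (actives \<Gamma>)"
  by (auto simp: cn_def simp flip: in_actives intro: rev_image_eqI)

lemma actives_eq_empty: "(\<And>T. T \<in># \<Gamma> \<Longrightarrow> active_term T = {#}) \<Longrightarrow> actives \<Gamma> = {#}"
  by (induction \<Gamma>) auto

lemma cn_subset_names: "cn \<Gamma> \<subseteq> names \<Gamma>"
  by (force simp: cn_def names_def)

lemma names_simps [simp]:
  "names {#} = {}"
  "names (add_mset T \<Gamma>) = cterm_names T \<union> names \<Gamma>"
  "names (\<Gamma> + \<Delta>) = names \<Gamma> \<union> names \<Delta>"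
  by (auto simp: names_def)

lemma finite_names: "finite (names \<Gamma>)"
proof -
  have pre: "finite (pre_names G)" for G :: "'a precond"
  proof (rule finite_subset)
    \<comment> \<open>The default 0 for the other atoms merely enlarges a finite superset.\<close>
    show "pre_names G \<subseteq> (\<lambda>g. case g of Dep P v (DName x) \<Rightarrow> x | _ \<Rightarrow> 0) ` set_mset G"
      by (force simp: pre_names_def)
  qed simp
  have adv: "finite (adv_names a)" for a :: "('a, 'b) adv"
    by (cases a) (auto simp: pre)
  have auth: "finite (auth_names \<xi>)" for \<xi> :: "('a, 'b) auth"
    by (cases \<xi>) (auto simp: adv)
  have "finite (cterm_names T)" for T :: "('a, 'b) cterm"
    by (cases T) (auto simp: adv auth)
  then show ?thesis by (simp add: names_def)
qed

lemma fresh_names: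
  fixes X :: "name set"
  assumes "finite X"
  obtains ys where "length ys = n" "distinct ys" "set ys \<inter> X = {}"
proof -
  have "infinite (UNIV - X)" by (rule Diff_infinite_finite[OF assms infinite_UNIV_nat])
  then obtain Y where "finite Y" "card Y = n" "Y \<subseteq> UNIV - X"
    by (meson infinite_arbitrarily_large)
  moreover from this obtain ys where "set ys = Y" "distinct ys"
    using finite_distinct_list by blast
  ultimately show ?thesis using that[of ys] distinct_card[of ys] by auto
qed

section \<open>Names held by contracts and deposits\<close>

primrec held_term :: "('p, 'x) cterm \<Rightarrow> name multiset" where
  "held_term (TAdv a) = {#}"
| "held_term (TActive C v x) = {#x#}"
| "held_term (TDep P v x) = {#x#}"
| "held_term (TAuth P \<xi>) = {#}"
| "held_term (TCommit P a N) = {#}"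
| "held_term (TReveal P a N) = {#}"
| "held_term (TBind P d x) = {#}"
| "held_term (TTime t) = {#}"

definition held :: "('p, 'x) config \<Rightarrow> name multiset" where
  "held \<Gamma> = (\<Sum>T \<in># \<Gamma>. held_term T)"

lemma held_simps [simp]:
  "held {#} = {#}"
  "held (add_mset T \<Gamma>) = held_term T + held \<Gamma>"
  "held (\<Gamma> + \<Delta>) = held \<Gamma> + held \<Delta>"
  by (auto simp: held_def)

text \<open>Turns the filter in \<open>wf_config\<close> into a multiplicity, which is additive and
  can be computed by simplification.\<close>

lemma count_held:
  "count (held \<Gamma>) x = size {#T \<in># \<Gamma>. (\<exists>C v. T = TActive C v x) \<or> (\<exists>P v. T = TDep P v x)#}"
proof (induction \<Gamma>)
  case (add T \<Gamma>)
  then show ?case by (cases T) auto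
qed simp

lemma actives_held: "image_mset snd (actives \<Gamma>) \<subseteq># held \<Gamma>"
proof (induction \<Gamma>)
  case (add T \<Gamma>)
  have "image_mset snd (active_term T) \<subseteq># held_term T" by (cases T) auto
  with add show ?case by (auto intro: subset_mset.add_mono)
qed simp

lemma held_names: "set_mset (held \<Gamma>) \<subseteq> names \<Gamma>"
proof (induction \<Gamma>)
  case (add T \<Gamma>)
  have "set_mset (held_term T) \<subseteq> cterm_names T" by (cases T) auto
  with add show ?case by auto
qed simp

lemma cn_subset_held: "cn \<Gamma> \<subseteq> set_mset (held \<Gamma>)"
  using set_mset_mono[OF actives_held[of \<Gamma>]] by (simp add: cn_actives)

section \<open>Abstract configurations as images of active contracts\<close>

definition abs_actives ::
  "('p \<Rightarrow> secret set) \<Rightarrow> 'p \<Rightarrow> (('p, 'x) ctr \<times> name) multiset \<Rightarrow> ('p, 'x) aconfig" where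
  "abs_actives S A M = {#AActive (abs_contract S A C) z. (C, z) \<in># M#}"

lemma abs_config_actives:
  "abs_config S A \<Y> \<Gamma> = abs_actives S A (filter_mset (\<lambda>(C, z). z \<in> \<Y>) (actives \<Gamma>))"
proof (induction \<Gamma>)
  case (add T \<Gamma>)
  then show ?case
    by (cases T) (auto simp: abs_config_def abs_actives_def)
qed (simp add: abs_config_def abs_actives_def)

lemma acn_simps [simp]:
  "acn {#} = {}"
  "acn (add_mset (AActive C x) \<Gamma>) = insert x (acn \<Gamma>)"
  "acn (add_mset (ARec X) \<Gamma>) = acn \<Gamma>"
  "acn (\<Gamma> + \<Delta>) = acn \<Gamma> \<union> acn \<Delta>"
  "acn (image_mset ARec Xs) = {}"
  by (auto simp: acn_def)

lemma acn_abs_actives [simp]: "acn (abs_actives S A M) = snd ` set_mset M"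
  by (force simp: acn_def abs_actives_def image_iff)

section \<open>The effect of a rule on the active contracts\<close>

context bitml
begin

text \<open>The provenance of a stipulated or renegotiated contract. The superscript is left open so
  that \<open>InitC\<close> and \<open>RngtC\<close> are covered together.\<close>

definition agreed :: "('p, 'x) config \<Rightarrow> 'p precond \<Rightarrow> ('p, 'x) ctr \<Rightarrow> bool" where
  "agreed \<Gamma> G C \<longleftrightarrow>
     (\<exists>o'. TAdv (Adv G o' C) \<in># \<Gamma> \<and> (\<forall>P \<in> pre_parts G. TAuth P (AuCommit (Adv G o' C)) \<in># \<Gamma>))"

lemma agreed_mono: "agreed \<Gamma> G C \<Longrightarrow> (\<And>a. TAdv a \<in># \<Gamma> \<Longrightarrow> TAdv a \<in># \<Gamma>') \<Longrightarrow>
    (\<And>P \<xi>. TAuth P \<xi> \<in># \<Gamma> \<Longrightarrow> TAuth P \<xi> \<in># \<Gamma>') \<Longrightarrow> agreed \<Gamma>' G C"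
  unfolding agreed_def by blast

text \<open>
  The contracts that replace an active contract whose chosen branch ends in the given action. Their
  names are arbitrary here, and freshness is imposed separately.
\<close>
inductive effect ::
  "('p, 'x) config \<Rightarrow> ('p, secret, intvar sexp, 'x) action \<Rightarrow> (('p, 'x) ctr \<times> name) multiset \<Rightarrow> bool"
  for \<Gamma> where
  "effect \<Gamma> (Withdraw P) {#}"
| "effect \<Gamma> (Reveal as p C) {#(C, y)#}"
| "image_mset snd M = mset Cs \<Longrightarrow> length ys = length Cs \<Longrightarrow> effect \<Gamma> (Split M) (mset (zip Cs ys))"
| "agreed \<Gamma> G C \<Longrightarrow> instance_of G C X es \<Longrightarrow> effect \<Gamma> (Rngt X es) {#(C, y)#}"

text \<open>Needed for \<open>Branch\<close>, whose premise concerns a configuration without the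
  authorizations and the time term.\<close>

lemma effect_mono: "effect \<Gamma> act N \<Longrightarrow> (\<And>a. TAdv a \<in># \<Gamma> \<Longrightarrow> TAdv a \<in># \<Gamma>') \<Longrightarrow>
    (\<And>P \<xi>. TAuth P \<xi> \<in># \<Gamma> \<Longrightarrow> TAuth P \<xi> \<in># \<Gamma>') \<Longrightarrow> effect \<Gamma>' act N"
  by (induction rule: effect.induct) (blast intro: effect.intros agreed_mono)+

definition fresh_in :: "('a \<times> name) multiset \<Rightarrow> name set \<Rightarrow> bool" where
  "fresh_in N X \<longleftrightarrow> distinct_mset (image_mset snd N) \<and> snd ` set_mset N \<inter> X = {}"

definition activates :: "('p, 'x) config \<Rightarrow> ('p, 'x) config \<Rightarrow> bool" where
  "activates \<Gamma> \<Gamma>' \<longleftrightarrow>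
     (\<exists>N. actives \<Gamma>' = N + actives \<Gamma> \<and> fresh_in N (cn \<Gamma>) \<and> (\<forall>(C, z) \<in># N. \<exists>G. agreed \<Gamma> G C))"

text \<open>The chosen branch is shown inside a sum and with its decorations, so that the basic
  rules and \<open>Branch\<close> fit the same shape.\<close>

definition consumes :: "('p, 'x) config \<Rightarrow> ('p, 'x) config \<Rightarrow> bool" where
  "consumes \<Gamma> \<Gamma>' \<longleftrightarrow>
     (\<exists>Ps es act Ds x M N.
        actives \<Gamma> = add_mset (Choice (add_mset (Guarded Ps es act) Ds), x) M \<and>
        actives \<Gamma>' = N + M \<and> fresh_in N (cn \<Gamma>) \<and> effect \<Gamma> act N)"

lemma consumesI:
  assumes "actives \<Gamma> = add_mset (Choice (add_mset (Guarded Ps es act) Ds), x) M"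
    "actives \<Gamma>' = N + M" "fresh_in N (cn \<Gamma>)" "effect \<Gamma> act N"
  shows "consumes \<Gamma> \<Gamma>'"
  using assms unfolding consumes_def by blast

lemma activatesI: "actives \<Gamma>' = actives \<Gamma> \<Longrightarrow> activates \<Gamma> \<Gamma>'"
  unfolding activates_def by (rule exI[of _ "{#}"]) (simp add: fresh_in_def)

lemma actives_stipulated [simp]: "actives (stipulated G a f) = {#}"
proof -
  have "active_term T = {#}" if "T \<in># stipulated_atom a f g" for T g
    using that by (induction a f g rule: stipulated_atom.induct) auto
  then show ?thesis
    by (intro actives_eq_empty) (auto simp: stipulated_def)
qed

lemma in_stipulated: "P \<in> pre_parts G \<Longrightarrow> TAuth P (AuCommit a) \<in># stipulated G a f"
proof -
  have "finite (atom_parts g)" for g :: "('p, secret, depvar) patom" by (cases g) auto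
  then have "finite (pre_parts G)" by (simp add: pre_parts_def)
  moreover assume "P \<in> pre_parts G"
  ultimately show ?thesis by (simp add: stipulated_def)
qed

lemma actives_map_empty [simp]:
  "actives (mset (map2 (TCommit P) as Ns)) = {#}" "actives (mset (map2 (TBind P) ds xs)) = {#}"
  "actives (mset (map (\<lambda>(P, v, x). TDep P v x) dps)) = {#}"
  "actives (mset (map (\<lambda>j. TAuth (F j) (H j)) js)) = {#}"
  "actives (mset (map (\<lambda>s. TReveal (Q s) s (N s)) as)) = {#}"
  "actives {#TAuth P (K P). P \<in># M#} = {#}"
  by (auto intro!: actives_eq_empty)

lemma actives_map2_split:
  "length ys = length bs \<Longrightarrow>
   actives (mset (map2 (\<lambda>(w', C) y. TActive C (v * w' / w) y) bs ys)) = mset (zip (map snd bs) ys)"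
  by (induction ys bs rule: list_induct2) auto

lemma rule_actives:
  "rule \<Gamma> l \<Gamma>' \<Longrightarrow> activates \<Gamma> \<Gamma>' \<or> consumes \<Gamma> \<Gamma>'"
proof (induction rule: rule.induct)
  case (InitC a G C \<Gamma>0 f \<Gamma> z)
  have "z \<notin> cn \<Gamma>0" using InitC cn_subset_names by blast
  moreover have "agreed \<Gamma>0 G C"
    unfolding agreed_def using InitC by (intro exI[of _ None]) (auto simp: in_stipulated)
  ultimately show ?case
    unfolding activates_def using InitC
    by (intro disjI1 exI[of _ "{#(C, z)#}"]) (auto simp: fresh_in_def)
next
  case (WithdrawC \<Gamma>0 P v x \<Gamma> y)
  show ?case
    by (rule disjI2, rule consumesI[where N = "{#}" and Ds = "{#}"])
      (use WithdrawC in \<open>auto simp: fresh_in_def intro: effect.intros\<close>)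
next
  case (SplitC \<Gamma>0 bs v x \<Gamma> w ys)
  have len: "length ys = length bs" by fact
  have N: "image_mset snd (mset (zip (map snd bs) ys)) = mset ys"
    using len by (simp flip: mset_map)
  then have "snd ` set_mset (mset (zip (map snd bs) ys)) = set ys"
    by (metis set_image_mset set_mset_mset)
  with N have "fresh_in (mset (zip (map snd bs) ys)) (cn \<Gamma>0)"
    unfolding fresh_in_def using SplitC cn_subset_names[of \<Gamma>0] by auto
  moreover have "effect \<Gamma>0 (Split (mset bs)) (mset (zip (map snd bs) ys))"
    using len by (intro effect.intros) auto
  moreover have "actives \<Gamma>0 = add_mset (Choice {#Guarded {#} {#} (Split (mset bs))#}, x) (actives \<Gamma>)"
    using SplitC by simp
  moreover have "actives (mset (map2 (\<lambda>(w', C) y. TActive C (v * w' / w) y) bs ys) + \<Gamma>) =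
      mset (zip (map snd bs) ys) + actives \<Gamma>"
    using actives_map2_split[OF len] by simp
  ultimately show ?case by (intro disjI2 consumesI)
next
  case (RevC \<Delta> Q N as \<Gamma>0 p C v x \<Gamma> y)
  have "y \<notin> cn \<Gamma>0" using RevC cn_subset_names by blast
  then show ?case
    by (intro disjI2, intro consumesI[where N = "{#(C, y)#}" and Ds = "{#}"])
      (use RevC in \<open>auto simp: fresh_in_def intro: effect.intros\<close>)
next
  case (Branch D Ps es D' v x \<Gamma> l \<Gamma>' t Ds)
  let ?I = "add_mset (TActive (Choice {#Guarded {#} {#} D'#}) v x) \<Gamma>"
  let ?O = "add_mset (TActive (Choice (add_mset D Ds)) v x)
            ({#TAuth P (AuBranch x D). P \<in># mset_set (set_mset Ps)#} + add_mset (TTime t) \<Gamma>)"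
  have I: "actives ?I = add_mset (Choice {#Guarded {#} {#} D'#}, x) (actives \<Gamma>)" by simp
  have O: "actives ?O = add_mset (Choice (add_mset D Ds), x) (actives \<Gamma>)" by simp
  \<comment> \<open>The premise of \<open>Branch\<close> could a priori be any rule. As
    \<open>x\<close> is gone afterwards, it is not an activation; and as untouched contracts
    persist, the consumed one must be the branch itself.\<close>
  have x: "(Choice {#Guarded {#} {#} D'#}, x) \<notin># actives \<Gamma>'"
    using \<open>x \<notin> cn \<Gamma>'\<close> by (force simp: cn_actives)
  then have "\<not> activates ?I \<Gamma>'" unfolding activates_def I by auto
  then have "consumes ?I \<Gamma>'" using Branch by blast
  then obtain Ps' es' act Ds' x' M N where *:
    "actives ?I = add_mset (Choice (add_mset (Guarded Ps' es' act) Ds'), x') M"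
    "actives \<Gamma>' = N + M" "fresh_in N (cn ?I)" "effect ?I act N"
    unfolding consumes_def by blast
  from *(2) x have "(Choice {#Guarded {#} {#} D'#}, x) \<notin># M" by auto
  with *(1) I have eq: "act = D'" "x' = x" "M = actives \<Gamma>"
    by (auto simp: add_eq_conv_ex)
  have "cn ?I = cn ?O" unfolding cn_actives O I by simp
  moreover have "effect ?O D' N"
    using *(4) unfolding eq by (rule effect_mono) auto
  ultimately show ?case
    using * O Branch(1) unfolding eq by (intro disjI2 consumesI[where N = N]) auto
next
  case (RngtC G C X es a x \<Gamma>0 Ds v f \<Gamma> y)
  have "agreed \<Gamma>0 G C"
    unfolding agreed_def using RngtC by (intro exI[of _ "Some x"]) (auto simp: in_stipulated)
  moreover have "y \<notin> cn \<Gamma>0" using RngtC cn_subset_names by blast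
  ultimately show ?case
    by (intro disjI2, intro consumesI[where N = "{#(C, y)#}"])
      (use RngtC in \<open>auto simp: fresh_in_def intro: effect.intros\<close>)
qed (auto intro!: activatesI actives_eq_empty)

lemma wf_distinct_held: "wf_config \<Gamma> \<Longrightarrow> distinct_mset (held \<Gamma>)"
  by (simp add: wf_config_def distinct_mset_def count_held)

lemma wf_distinct_actives: "wf_config \<Gamma> \<Longrightarrow> distinct_mset (image_mset snd (actives \<Gamma>))"
  using distinct_mset_mono[OF actives_held] wf_distinct_held by blast

section \<open>Every concrete run has an abstract counterpart\<close>

text \<open>The abstraction sees secrets only through membership in \<open>S A\<close>, predicates
  only through being \<open>PTrue\<close>, and static expressions not at all.\<close>

lemma abs_map_contract:
  fixes C :: "('p, 'x) ctr" and D :: "('p, 'x) grd" and act :: "('p, secret, intvar sexp, 'x) action"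
  shows
  "(\<And>s. s \<in> ctr_secrets C \<Longrightarrow> \<sigma> s \<in> S A \<longleftrightarrow> s \<in> S A) \<Longrightarrow>
     abs_contract S A (map_contract (\<lambda>x. x) \<sigma> h (\<lambda>x. x) C) = abs_contract S A C"
  "(\<And>s. s \<in> grd_secrets D \<Longrightarrow> \<sigma> s \<in> S A \<longleftrightarrow> s \<in> S A) \<Longrightarrow>
     abs_guarded S A (map_guarded (\<lambda>x. x) \<sigma> h (\<lambda>x. x) D) = abs_guarded S A D"
  "(\<And>s. s \<in> act_secrets act \<Longrightarrow> \<sigma> s \<in> S A \<longleftrightarrow> s \<in> S A) \<Longrightarrow>
     abs_action S A (map_action (\<lambda>x. x) \<sigma> h (\<lambda>x. x) act) = abs_action S A act"
proof (induction C and D and act)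
  case (Choice Ds)
  have "abs_guarded S A (map_guarded (\<lambda>x. x) \<sigma> h (\<lambda>x. x) D) = abs_guarded S A D" if "D \<in># Ds" for D
    using Choice that by auto
  then show ?case by (auto simp: multiset.map_comp intro!: image_mset_cong)
next
  case (Guarded Ps es act)
  then show ?case by auto
next
  case (Reveal as p C)
  have "map_pred \<sigma> h p = PTrue \<longleftrightarrow> p = PTrue" by (cases p) auto
  moreover have "\<sigma> ` set as \<subseteq> S A \<longleftrightarrow> set as \<subseteq> S A" using Reveal by auto
  ultimately show ?case using Reveal by auto
next
  case (Split M)
  have "abs_contract S A (map_contract (\<lambda>x. x) \<sigma> h (\<lambda>x. x) (snd b)) = abs_contract S A (snd b)" if "b \<in># M" for b
    using Split(1)[OF that, of "snd b"] Split(2) that by (cases b) force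
  then show ?case by (auto simp: multiset.map_comp intro!: image_mset_cong)
qed auto

lemma agreed_wf: "wf_config \<Gamma> \<Longrightarrow> agreed \<Gamma> G C \<Longrightarrow> \<exists>o'. wf_adv (Adv G o' C)"
  unfolding agreed_def wf_config_def by force

text \<open>Secrets of a well-formed advertisement occur in its precondition next to their owner.
  The renaming leaves participants fixed, so \<open>s\<close> and its image lie in the same
  \<open>S P\<close>, and disjointness settles membership in \<open>S A\<close>.\<close>

lemma abs_instance:
  assumes "wf_adv (Adv G o' C)" "instance_of G C X es"
  shows "abs_contract S A C = abs_contract S A (body X)"
proof -
  obtain \<sigma> \<theta> h where bij: "bij \<sigma>" and G: "G = image_mset (map_patom id \<sigma> \<theta>) (pre X)"
    and C: "C = map_contract id \<sigma> h id (body X)"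
    using assms(2) unfolding instance_of_def by blast
  have "\<sigma> s \<in> S A \<longleftrightarrow> s \<in> S A" if s: "s \<in> ctr_secrets (body X)" for s
  proof -
    have "\<sigma> s \<in> ctr_secrets C" using s by (simp add: C contract.set_map)
    then have "\<sigma> s \<in> pre_secrets G" using assms(1) by auto
    then obtain g where g: "g \<in># pre X" "\<sigma> s \<in> atom_secrets (map_patom id \<sigma> \<theta> g)"
      unfolding G pre_secrets_def by auto
    \<comment> \<open>Injectivity of \<sigma> ensures that the renamed atom stems from
      \<open>s\<close> and not from another secret.\<close>
    then obtain P where P: "g = Sec P s"
      using bij by (cases g) (auto simp: bij_def inj_eq)
    have "s \<in> S P" using g P pre_wf unfolding wf_pre_def by blast
    moreover have "Sec P (\<sigma> s) \<in># G" using g P unfolding G by force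
    then have "\<sigma> s \<in> S P" using assms(1) by (auto simp: wf_pre_def)
    ultimately show ?thesis using S_disjoint by (metis disjoint_iff)
  qed
  then show ?thesis unfolding C id_def by (rule abs_map_contract(1))
qed

text \<open>The abstract step reuses the concrete names of \<open>N\<close>. \<open>Xs\<close>
  collects the recursion variable that an abstract renegotiation leaves behind.\<close>

lemma effect_abs_action:
  assumes "effect \<Gamma> act N" "wf_config \<Gamma>" "fresh_in N (insert x (acn M))"
  shows "\<exists>b Xs. astep A (add_mset (AActive (AChoice {#abs_action S A act#}) x) M) (ALab b x)
           (abs_actives S A N + image_mset ARec Xs + M)"
  using assms
proof (induction rule: effect.induct)
  case (1 P)
  then show ?case
    by (intro exI[of _ False] exI[of _ "{#}"]) (auto simp: abs_actives_def intro: astep.intros)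
next
  case (2 as p C y)
  then have *: "astep A (add_mset (AActive (AChoice {#ATau (abs_contract S A C)#}) x) M) (ALab False x)
           (add_mset (AActive (abs_contract S A C) y) M)"
    by (intro astep.intros) (auto simp: fresh_in_def)
  moreover have "astep A (add_mset (AActive (AChoice {#AStar (ATau (abs_contract S A C))#}) x) M)
      (ALab True x) (add_mset (AActive (abs_contract S A C) y) M)"
    using astep.intros(5)[OF *] by (simp add: alab_star_def)
  ultimately show ?case
    by (intro exI[of _ "\<not> (p = PTrue \<and> set as \<subseteq> S A)"] exI[of _ "{#}"])
       (auto simp: abs_actives_def)
next
  case (3 Ms Cs ys)
  have N: "image_mset snd (mset (zip Cs ys)) = mset ys"
    using 3 by (simp flip: mset_map)
  then have "snd ` set_mset (mset (zip Cs ys)) = set ys"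
    by (metis set_image_mset set_mset_mset)
  with N have "distinct ys" "set ys \<inter> insert x (acn M) = {}"
    using 3 by (auto simp: fresh_in_def)
  then have "astep A (add_mset (AActive (AChoice {#ASplit (mset (map (abs_contract S A) Cs))#}) x) M)
      (ALab False x) (mset (map2 AActive (map (abs_contract S A) Cs) ys) + M)"
    using 3 by (intro astep.intros) auto
  moreover have "mset (map2 AActive (map (abs_contract S A) Cs) ys) = abs_actives S A (mset (zip Cs ys))"
    using \<open>length ys = length Cs\<close> by (induction ys Cs rule: list_induct2) (auto simp: abs_actives_def)
  moreover have "abs_action S A (Split Ms) = ASplit (mset (map (abs_contract S A) Cs))"
    using arg_cong[OF 3(1), of "image_mset (abs_contract S A)"]
    by (simp add: multiset.map_comp comp_def)
  ultimately show ?case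
    by (intro exI[of _ False] exI[of _ "{#}"]) auto
next
  case (4 G C X es y)
  then obtain o' where "wf_adv (Adv G o' C)" using agreed_wf by blast
  then have "abs_contract S A C = abs_contract S A (body X)"
    using 4(2) by (rule abs_instance)
  moreover have "astep A (add_mset (AActive (AChoice {#AStar (ARngt X)#}) x) M) (ALab True x)
     (add_mset (AActive (abs_contract S A (body X)) y) (add_mset (ARec X) M))"
    using 4(4) by (intro astep.intros(6)) (simp add: fresh_in_def)
  ultimately show ?case
    by (intro exI[of _ True] exI[of _ "{#X#}"]) (auto simp: abs_actives_def add_mset_commute)
qed

lemma effect_abs_contract:
  assumes "effect \<Gamma> act N" "wf_config \<Gamma>" "fresh_in N (insert x (acn M))"
  shows "\<exists>l Xs. astep A
           (add_mset (AActive (abs_contract S A (Choice (add_mset (Guarded Ps es act) Ds))) x) M) l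
           (abs_actives S A N + image_mset ARec Xs + M)"
proof -
  obtain b Xs where *: "astep A (add_mset (AActive (AChoice {#abs_action S A act#}) x) M) (ALab b x)
           (abs_actives S A N + image_mset ARec Xs + M)"
    using effect_abs_action[OF assms] by blast
  have "\<exists>b. astep A (add_mset (AActive (AChoice {#abs_guarded S A (Guarded Ps es act)#}) x) M)
     (ALab b x) (abs_actives S A N + image_mset ARec Xs + M)"
  \<comment> \<open>Decorations add at most one star, and an action that is starred already absorbs
    it; the comparison separates exactly the situations in which a star is really added.\<close>
  proof (cases "abs_guarded S A (Guarded Ps es act) = abs_action S A act")
    case True
    then show ?thesis using * by metis
  next
    case False
    then have "abs_guarded S A (Guarded Ps es act) = AStar (abs_action S A act)"
      by (auto simp: astar_def split: aguarded.splits if_splits)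
    then show ?thesis using astep.intros(5)[OF *] by (simp add: alab_star_def) blast
  qed
  then obtain b where "astep A (add_mset (AActive (AChoice {#abs_guarded S A (Guarded Ps es act)#}) x) M)
     (ALab b x) (abs_actives S A N + image_mset ARec Xs + M)" ..
  from astep.intros(4)[OF this, of "image_mset (abs_guarded S A) Ds"] show ?thesis
    by (simp only: abs_contract.simps image_mset_add_mset alabel.sel) blast
qed

lemma abs_config_unchanged:
  assumes "actives \<Gamma>' = N + M" "fresh_in N X" "\<Y> \<subseteq> X"
  shows "abs_config S A \<Y> \<Gamma>' = abs_actives S A {#(C, z) \<in># M. z \<in> \<Y>#}"
proof -
  have "{#(C, z) \<in># N. z \<in> \<Y>#} = filter_mset (\<lambda>_. False) N"
    using assms(2,3) by (intro filter_mset_cong) (force simp: fresh_in_def)+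
  then have *: "{#(C, z) \<in># N. z \<in> \<Y>#} = {#}" by simp
  show ?thesis unfolding abs_config_actives assms(1) filter_union_mset * by simp
qed

text \<open>The tracked set has to vary along the run: it consists of the current names whose origin
  lies in \<X>. The abstract run grows only when a tracked contract is consumed.\<close>

lemma abstract_run:
  assumes "is_run cstep R" "wf_config (run_first R)" "\<X> \<subseteq> cn (run_first R)"
  shows "\<exists>R' Xs. is_run (astep A) R' \<and> run_first R' = abs_config S A \<X> (run_first R) \<and>
    run_last R' =
      abs_config S A {z. \<exists>w \<in> \<X>. orig cn R z = Some w} (run_last R) + image_mset ARec Xs \<and>
    (\<forall>z. \<forall>w \<in> \<X>. orig cn R z = Some w \<longrightarrow> orig acn R' z = Some w)"
  using assms
proof (induction R)
  case (Start \<Gamma>)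
  have Y: "{z. \<exists>w\<in>\<X>. orig cn (Start \<Gamma>) z = Some w} = \<X>"
    using Start by auto
  have "acn (abs_config S A \<X> \<Gamma>) = \<X>"
    using Start by (force simp: abs_config_actives cn_actives)
  then show ?case
    unfolding Y by (intro exI[of _ "Start (abs_config S A \<X> \<Gamma>)"] exI[of _ "{#}"]) auto
next
  case (Extend R l \<Gamma>')
  let ?\<Gamma> = "run_last R"
  let ?Y = "{z. \<exists>w\<in>\<X>. orig cn R z = Some w}" and ?Y' = "{z. \<exists>w\<in>\<X>. orig cn (Extend R l \<Gamma>') z = Some w}"
  have step: "cstep ?\<Gamma> l \<Gamma>'" using Extend by simp
  then have wf: "wf_config ?\<Gamma>" and rule: "rule ?\<Gamma> l \<Gamma>'" by (auto simp: cstep_def)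
  obtain R' Xs where R': "is_run (astep A) R'" "run_first R' = abs_config S A \<X> (run_first R)"
    "run_last R' = abs_config S A ?Y ?\<Gamma> + image_mset ARec Xs"
    and orig: "\<And>z w. w \<in> \<X> \<Longrightarrow> orig cn R z = Some w \<Longrightarrow> orig acn R' z = Some w"
    using Extend by auto
  have Y: "?Y \<subseteq> cn ?\<Gamma>" using orig_in_last by fast
  show ?case
  proof (cases "activates ?\<Gamma> \<Gamma>'")
    case True
    then obtain N where N: "actives \<Gamma>' = N + actives ?\<Gamma>" "fresh_in N (cn ?\<Gamma>)"
      unfolding activates_def by blast
    then have o: "orig cn (Extend R l \<Gamma>') z = orig cn R z" for z
      by (intro orig_activates[where F = "snd ` set_mset N"]) (auto simp: cn_actives)
    have "abs_config S A ?Y \<Gamma>' = abs_config S A ?Y ?\<Gamma>"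
      using abs_config_unchanged[OF N Y] by (simp only: abs_config_actives)
    with R' orig show ?thesis
      unfolding o run_last.simps run_first.simps by (intro exI[of _ R'] exI[of _ Xs]) auto
  next
    case False
    then have "consumes ?\<Gamma> \<Gamma>'" using rule_actives[OF rule] by blast
    then obtain Ps es act Ds x M N where *:
      "actives ?\<Gamma> = add_mset (Choice (add_mset (Guarded Ps es act) Ds), x) M"
      "actives \<Gamma>' = N + M" and fresh: "fresh_in N (cn ?\<Gamma>)" and eff: "effect ?\<Gamma> act N"
      unfolding consumes_def by blast
    let ?F = "snd ` set_mset N" and ?B = "snd ` set_mset M"
    have x: "x \<notin> ?B" using wf_distinct_actives[OF wf] * by simp
    have F: "?F \<inter> insert x ?B = {}" using fresh * by (auto simp: fresh_in_def cn_actives)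
    have o: "orig cn (Extend R l \<Gamma>') z =
        (if z \<in> ?F then orig cn R x else if z = x then None else orig cn R z)" for z
      by (rule orig_consumes[OF _ x _ F]) (auto simp: cn_actives *)
    show ?thesis
    proof (cases "x \<in> ?Y")
      \<comment> \<open>The consumed contract is untracked, so its replacements inherit an origin
        outside \<X> or none at all, and the abstract run stays as it is.\<close>
      case False
      have "z \<notin> ?F" if "orig cn R z = Some w" for z w
        using that fresh orig_in_last unfolding fresh_in_def by fast
      then have "?Y' = ?Y" using False unfolding o by auto
      then have eq: "abs_config S A ?Y' \<Gamma>' = abs_config S A ?Y ?\<Gamma>"
        using False abs_config_unchanged[OF *(2) fresh Y] *(1) by (simp add: abs_config_actives)
      have "orig cn R z = Some w" if "orig cn (Extend R l \<Gamma>') z = Some w" "w \<in> \<X>" for z w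
        using that False unfolding o by (auto split: if_splits)
      then have "\<forall>z. \<forall>w\<in>\<X>. orig cn (Extend R l \<Gamma>') z = Some w \<longrightarrow> orig acn R' z = Some w"
        using orig by blast
      with R' eq show ?thesis
        unfolding run_last.simps run_first.simps
        by (intro exI[of _ R'] exI[of _ Xs] conjI; simp only:)
    next
      case True
      let ?M = "{#(C, z) \<in># M. z \<in> ?Y#}"
      have "{#(C, z) \<in># N. z \<in> ?Y'#} = N"
        using True unfolding o by (force simp: filter_mset_eq_conv)
      moreover have "{#(C, z) \<in># M. z \<in> ?Y'#} = ?M"
      proof (intro filter_mset_cong refl, clarify)
        fix C z assume "(C, z) \<in># M"
        then have "z \<in> ?B" by force
        then have "z \<notin> ?F" "z \<noteq> x" using x F by blast+
        then show "z \<in> ?Y' \<longleftrightarrow> z \<in> ?Y" unfolding o by simp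
      qed
      ultimately have last: "abs_config S A ?Y' \<Gamma>' = abs_actives S A N + abs_actives S A ?M"
        by (simp add: abs_config_actives * abs_actives_def)
      have first: "abs_config S A ?Y ?\<Gamma> =
          add_mset (AActive (abs_contract S A (Choice (add_mset (Guarded Ps es act) Ds))) x) (abs_actives S A ?M)"
        using True by (simp add: abs_config_actives * abs_actives_def)
      \<comment> \<open>The abstract configuration carries fewer names, so concrete freshness
        implies abstract freshness.\<close>
      have fresh': "fresh_in N (insert x (acn (abs_actives S A ?M + image_mset ARec Xs)))"
        using fresh * by (auto simp: fresh_in_def cn_actives)
      obtain l' Xs' where astep: "astep A (run_last R') l'
          (abs_actives S A N + image_mset ARec Xs' + (abs_actives S A ?M + image_mset ARec Xs))"
        using effect_abs_contract[OF eff wf fresh'] R'(3) unfolding first by force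
      let ?\<Delta> = "abs_actives S A N + image_mset ARec Xs' + (abs_actives S A ?M + image_mset ARec Xs)"
      have o': "orig acn (Extend R' l' ?\<Delta>) z =
        (if z \<in> ?F then orig acn R' x else if z = x then None else orig acn R' z)" for z
      proof (rule orig_consumes)
        show "acn (run_last R') = insert x (snd ` set_mset ?M)"
          unfolding R' first by simp
      qed (use x F in auto)
      have "orig acn (Extend R' l' ?\<Delta>) z = Some w"
        if "orig cn (Extend R l \<Gamma>') z = Some w" "w \<in> \<X>" for z w
        using that orig unfolding o o' by (auto split: if_splits)
      moreover have "?\<Delta> = abs_config S A ?Y' \<Gamma>' + image_mset ARec (Xs' + Xs)"
        unfolding last by simp
      ultimately show ?thesis
        using R' astep by (intro exI[of _ "Extend R' l' ?\<Delta>"] exI[of _ "Xs' + Xs"]) auto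
    qed
  qed
qed

end

section \<open>Abstract contracts that can be terminated without stars\<close>

text \<open>There is no clause for \<open>AStar\<close>, since its labels are starred; this excludes
  renegotiation altogether. An empty split is killable at once.\<close>

inductive killable :: "('p, 'x) acontract \<Rightarrow> bool" where
  "AWithdraw P \<in># Ds \<Longrightarrow> killable (AChoice Ds)"
| "ATau C \<in># Ds \<Longrightarrow> killable C \<Longrightarrow> killable (AChoice Ds)"
| "ASplit Cs \<in># Ds \<Longrightarrow> (\<And>C. C \<in># Cs \<Longrightarrow> killable C) \<Longrightarrow> killable (AChoice Ds)"

lemma killable_mono: "killable (AChoice Ds) \<Longrightarrow> set_mset Ds \<subseteq> set_mset Ds' \<Longrightarrow> killable (AChoice Ds')"
  by (erule killable.cases) (auto intro: killable.intros)

section \<open>Abstract steps read backwards\<close>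

definition anames :: "('p, 'x) aconfig \<Rightarrow> name multiset" where
  "anames \<Gamma> = (\<Sum>T \<in># \<Gamma>. case T of AActive C x \<Rightarrow> {#x#} | ARec X \<Rightarrow> {#})"

lemma anames_simps [simp]:
  "anames {#} = {#}"
  "anames (add_mset (AActive C x) \<Gamma>) = add_mset x (anames \<Gamma>)"
  "anames (add_mset (ARec X) \<Gamma>) = anames \<Gamma>"
  "anames (\<Gamma> + \<Delta>) = anames \<Gamma> + anames \<Delta>"
  "anames (image_mset ARec Xs) = {#}"
  by (auto simp: anames_def)

lemma set_anames [simp]: "set_mset (anames \<Gamma>) = acn \<Gamma>"
proof (induction \<Gamma>)
  case (add T \<Gamma>)
  then show ?case by (cases T) auto
qed simp

lemma anames_abs_actives [simp]: "anames (abs_actives S A M) = image_mset snd M"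
  by (induction M) (auto simp: abs_actives_def)

lemma anames_map2_AActive:
  "length ys = length Cs \<Longrightarrow> anames (mset (map2 AActive Cs ys)) = mset ys"
  by (induction ys Cs rule: list_induct2) auto

lemma ex_AActive_map2:
  "length ys = length Cs \<Longrightarrow> C \<in> set Cs \<Longrightarrow> \<exists>z. AActive C z \<in> set (map2 AActive Cs ys)"
  by (induction ys Cs rule: list_induct2) auto

context bitml
begin

text \<open>Quantifying over all decompositions makes the induction hypotheses usable in the rules
  for sums and stars. Killability is pulled back from the replacements to the consumed contract, and
  claimed only for unstarred labels.\<close>

lemma astep_cases:
  assumes "astep A \<Gamma> l \<Gamma>'"
  shows "alab_name l \<in> acn \<Gamma> \<and>
    (\<forall>K M. \<Gamma> = add_mset (AActive K (alab_name l)) M \<longrightarrow> alab_name l \<notin> acn M \<longrightarrow>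
      (\<exists>N. \<Gamma>' = N + M \<and> distinct_mset (anames N) \<and> acn N \<inter> insert (alab_name l) (acn M) = {} \<and>
        (l \<in> alabels \<longrightarrow> (\<forall>C z. AActive C z \<in># N \<longrightarrow> killable C) \<longrightarrow> killable K)))"
    (is "?I \<and> (\<forall>K M. ?P K M)")
proof -
  \<comment> \<open>As the consumed name occurs once, the decomposition is unique, and only the
    displayed one has to be checked.\<close>
  have I: "alab_name l \<in> acn (add_mset (AActive K0 x) \<Gamma>0) \<and>
    (\<forall>K M. add_mset (AActive K0 x) \<Gamma>0 = add_mset (AActive K (alab_name l)) M \<longrightarrow>
      alab_name l \<notin> acn M \<longrightarrow> Q K M)"
    if "alab_name l = x" "x \<notin> acn \<Gamma>0 \<Longrightarrow> Q K0 \<Gamma>0" for K0 x Q l and \<Gamma>0 :: "('p, 'x) aconfig"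
    using that by (auto simp: add_eq_conv_ex)
  show ?thesis
    using assms
  proof (induction rule: astep.induct)
    case (1 P x \<Gamma>)
    show ?case
      by (rule I, simp, rule exI[of _ "{#}"]) (auto intro: killable.intros)
  next
    case (2 y x \<Gamma> C)
    then show ?case
      by (intro I, simp, intro exI[of _ "{#AActive C y#}"]) (auto intro: killable.intros)
  next
    case (3 ys Cs x \<Gamma>)
    have N: "acn (mset (map2 AActive Cs ys)) = set ys"
      using anames_map2_AActive[OF 3(1)] by (metis set_anames set_mset_mset)
    have "killable (AChoice {#ASplit (mset Cs)#})"
      if "\<forall>C z. AActive C z \<in># mset (map2 AActive Cs ys) \<longrightarrow> killable C"
      using that ex_AActive_map2[OF 3(1)] by (intro killable.intros(3)[of "mset Cs"]) auto
    then show ?case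
      using 3 N anames_map2_AActive[OF 3(1)]
      by (intro I, simp, intro exI[of _ "mset (map2 AActive Cs ys)"]) auto
  next
    case (4 D x \<Gamma> l \<Gamma>' Ds)
    show ?case
    proof (rule I)
      assume "x \<notin> acn \<Gamma>"
      then obtain N where N: "\<Gamma>' = N + \<Gamma>" "distinct_mset (anames N)"
        "acn N \<inter> insert (alab_name l) (acn \<Gamma>) = {}"
        "l \<in> alabels \<longrightarrow> (\<forall>C z. AActive C z \<in># N \<longrightarrow> killable C) \<longrightarrow> killable (AChoice {#D#})"
        using 4(2,3) by blast
      moreover have "killable (AChoice {#D#}) \<Longrightarrow> killable (AChoice (add_mset D Ds))"
        by (erule killable_mono) simp
      ultimately show "\<exists>N. \<Gamma>' = N + \<Gamma> \<and> distinct_mset (anames N) \<and>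
          acn N \<inter> insert (alab_name l) (acn \<Gamma>) = {} \<and>
          (l \<in> alabels \<longrightarrow> (\<forall>C z. AActive C z \<in># N \<longrightarrow> killable C) \<longrightarrow> killable (AChoice (add_mset D Ds)))"
        by blast
    qed (simp add: 4(2))
  next
    case (5 D x \<Gamma> l \<Gamma>')
    have star: "alab_name (alab_star l) = x" "alab_star l \<notin> alabels"
      by (auto simp: alab_star_def alabels_def 5(2))
    show ?case
    proof (rule I)
      assume "x \<notin> acn \<Gamma>"
      then obtain N where "\<Gamma>' = N + \<Gamma>" "distinct_mset (anames N)"
        "acn N \<inter> insert (alab_name l) (acn \<Gamma>) = {}"
        using 5(2,3) by blast
      then show "\<exists>N. \<Gamma>' = N + \<Gamma> \<and> distinct_mset (anames N) \<and>
          acn N \<inter> insert (alab_name (alab_star l)) (acn \<Gamma>) = {} \<and>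
          (alab_star l \<in> alabels \<longrightarrow> (\<forall>C z. AActive C z \<in># N \<longrightarrow> killable C) \<longrightarrow>
            killable (AChoice {#AStar D#}))"
        using star 5(2) by blast
    qed (fact star)
  next
    case (6 y x \<Gamma> X)
    then show ?case
      by (intro I, simp, intro exI[of _ "{#AActive (abs_contract S A (body X)) y, ARec X#}"])
        (auto simp: alabels_def)
  qed
qed

lemma astep_consumes:
  assumes "astep A \<Gamma> l \<Gamma>'" "distinct_mset (anames \<Gamma>)"
  obtains K M N where "\<Gamma> = add_mset (AActive K (alab_name l)) M" "\<Gamma>' = N + M"
    "alab_name l \<notin> acn M" "acn N \<inter> insert (alab_name l) (acn M) = {}"
    "distinct_mset (anames \<Gamma>')"
    "l \<in> alabels \<longrightarrow> (\<forall>C z. AActive C z \<in># N \<longrightarrow> killable C) \<longrightarrow> killable K"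
proof -
  obtain K where "AActive K (alab_name l) \<in># \<Gamma>"
    using astep_cases[OF assms(1)] by (auto simp: acn_def)
  then obtain M where M: "\<Gamma> = add_mset (AActive K (alab_name l)) M" by (meson multi_member_split)
  then have "alab_name l \<notin> acn M" using assms(2) by simp
  moreover from this obtain N where "\<Gamma>' = N + M" "distinct_mset (anames N)"
    "acn N \<inter> insert (alab_name l) (acn M) = {}"
    "l \<in> alabels \<longrightarrow> (\<forall>C z. AActive C z \<in># N \<longrightarrow> killable C) \<longrightarrow> killable K"
    using astep_cases[OF assms(1)] M by blast
  ultimately show ?thesis
    using that[OF M] assms(2) M by (auto simp: distinct_mset_union)
qed

lemma anames_run:
  "is_run (astep A) R \<Longrightarrow> distinct_mset (anames (run_first R)) \<Longrightarrow> distinct_mset (anames (run_last R))"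
  by (induction R) (auto elim: astep_consumes)

text \<open>Generalized from runs that remove all descendants of \<open>y\<close> to runs whose
  remaining descendants are killable, so that the induction can strip off the last step.\<close>

lemma killable_origin:
  assumes "is_run (astep A) R" "run_labels R \<subseteq> alabels" "distinct_mset (anames (run_first R))"
    "AActive K y \<in># run_first R"
    "\<And>C z. AActive C z \<in># run_last R \<Longrightarrow> orig acn R z = Some y \<Longrightarrow> killable C"
  shows "killable K"
  using assms
proof (induction R)
  case (Start \<Gamma>)
  then have "y \<in> acn \<Gamma>" by (auto simp: acn_def)
  then show ?case using Start(4) Start(5)[of K y] by simp
next
  case (Extend R l \<Gamma>')
  have "astep A (run_last R) l \<Gamma>'" "distinct_mset (anames (run_last R))"
    using Extend anames_run by auto
  then obtain K' M N where *: "run_last R = add_mset (AActive K' (alab_name l)) M" "\<Gamma>' = N + M"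
    "alab_name l \<notin> acn M" "acn N \<inter> insert (alab_name l) (acn M) = {}"
    "l \<in> alabels \<longrightarrow> (\<forall>C z. AActive C z \<in># N \<longrightarrow> killable C) \<longrightarrow> killable K'"
    by (elim astep_consumes) blast
  have o: "orig acn (Extend R l \<Gamma>') z =
      (if z \<in> acn N then orig acn R (alab_name l)
       else if z = alab_name l then None else orig acn R z)" for z
    using * by (intro orig_consumes) auto
  show ?case
  proof (rule Extend.IH)
    fix C z assume C: "AActive C z \<in># run_last R" "orig acn R z = Some y"
    show "killable C"
    proof (cases "AActive C z = AActive K' (alab_name l)")
      case True
      \<comment> \<open>The replacements inherit the origin \<open>y\<close> of the consumed
        contract, so the assumption about the end of the run applies to them.\<close>
      have "killable C'" if "AActive C' u \<in># N" for C' u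
      proof (rule Extend.prems(5))
        show "AActive C' u \<in># run_last (Extend R l \<Gamma>')" using that * by simp
        have "u \<in> acn N" using that by (auto simp: acn_def)
        then show "orig acn (Extend R l \<Gamma>') u = Some y" using C True unfolding o by simp
      qed
      then show ?thesis using *(5) True Extend.prems by auto
    next
      case False
      then have "AActive C z \<in># M" using C * by auto
      then have "z \<in> acn M" by (auto simp: acn_def)
      show ?thesis
      proof (rule Extend.prems(5))
        show "AActive C z \<in># run_last (Extend R l \<Gamma>')" using \<open>AActive C z \<in># M\<close> * by simp
        show "orig acn (Extend R l \<Gamma>') z = Some y"
          using C \<open>z \<in> acn M\<close> * unfolding o by auto
      qed
    qed
  qed (use Extend.prems in auto)
qed

text \<open>At the end of a liquidating run no descendant of \<open>y\<close> is left, so the last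
  assumption of \<open>killable_origin\<close> holds vacuously.\<close>

lemma liquidable_killable:
  assumes "liquidable (astep A) acn alabels \<Gamma> y" "distinct_mset (anames \<Gamma>)" "AActive K y \<in># \<Gamma>"
  shows "killable K"
  using assms unfolding liquidable_def by (force simp: acn_def intro: killable_origin)

section \<open>An invariant of reachable configurations\<close>

text \<open>A commitment to \<open>None\<close> could never be revealed. The disjunction is what
  remains stable, since revealing replaces the commitment.\<close>

definition secured :: "'p \<Rightarrow> secret \<Rightarrow> ('p, 'x) config \<Rightarrow> bool" where
  "secured A s \<Gamma> \<longleftrightarrow> (\<exists>N. TCommit A s (Some N) \<in># \<Gamma>) \<or> (\<exists>N. TReveal A s N \<in># \<Gamma>)"

lemma no_secret_in_stipulated [simp]:
  "TCommit P s N \<notin># stipulated G a f" "TReveal P s N' \<notin># stipulated G a f"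
proof -
  have *: "TCommit P s N \<notin># stipulated_atom a f g" "TReveal P s N' \<notin># stipulated_atom a f g" for g
    by (induction a f g rule: stipulated_atom.induct) auto
  show "TCommit P s N \<notin># stipulated G a f" "TReveal P s N' \<notin># stipulated G a f"
    by (auto simp: stipulated_def *)
qed

lemma rule_secured: "rule \<Gamma> l \<Gamma>' \<Longrightarrow> secured A s \<Gamma> \<Longrightarrow> secured A s \<Gamma>'"
  by (induction rule: rule.induct) (auto simp: secured_def)

text \<open>The authorization is added by \<open>AuthCommit\<close> only, together with commitments
  to all secrets of \<open>A\<close> in \<open>G\<close>; honesty excludes the value
  \<open>None\<close>.\<close>

lemma rule_commit:
  assumes "rule \<Gamma> l \<Gamma>'" "A \<in> Hon" "TAuth A (AuCommit (Adv G o' C)) \<in># \<Gamma>'" "Sec A s \<in># G"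
  shows "TAuth A (AuCommit (Adv G o' C)) \<in># \<Gamma> \<or> secured A s \<Gamma>'"
  using assms
proof (induction rule: rule.induct)
  case (AuthCommit \<Gamma>0 a \<Gamma> G' o'' C' as P Ns ds xs \<Delta>)
  show ?case
  proof (cases "TAuth A (AuCommit (Adv G o' C)) \<in># \<Gamma>0")
    case False
    then have "P = A" "G' = G"
      using AuthCommit by (auto simp: in_multiset_in_set)
    then have "s \<in> set as" using AuthCommit by simp
    then obtain i where i: "i < length as" "as ! i = s" by (auto simp: in_set_conv_nth)
    then have "Ns ! i \<in> set Ns" using AuthCommit by simp
    moreover have "None \<notin> set Ns" using AuthCommit \<open>P = A\<close> by blast
    ultimately obtain N where N: "Ns ! i = Some N" by (metis not_None_eq)
    have "(s, Some N) \<in> set (zip as Ns)"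
      using i N \<open>length Ns = length as\<close> by (force simp: in_set_zip)
    then have "TCommit A s (Some N) \<in># \<Delta>"
      unfolding \<open>\<Delta> = _\<close> \<open>P = A\<close> by force
    then show ?thesis by (auto simp: secured_def)
  qed auto
next
  case (Branch D Ps es D' v x \<Gamma> l \<Gamma>' t Ds)
  then show ?case by (auto simp: secured_def)
qed auto

text \<open>Closedness is demanded by \<open>Branch\<close> but is not part of well-formedness of
  active contracts. The clause on commit authorizations supplies the clause on secrets whenever a
  contract is stipulated.\<close>

definition consistent :: "'p \<Rightarrow> ('p, 'x) config \<Rightarrow> bool" where
  "consistent A \<Gamma> \<longleftrightarrow> wf_config \<Gamma> \<and> timed \<Gamma> \<and>
     (\<forall>(C, z) \<in># actives \<Gamma>.
        (\<forall>e \<in> ctr_sexps C. closed_sexp e) \<and> (\<forall>s \<in> ctr_secrets C \<inter> S A. secured A s \<Gamma>)) \<and>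
     (\<forall>G o' C s. TAuth A (AuCommit (Adv G o' C)) \<in># \<Gamma> \<longrightarrow> Sec A s \<in># G \<longrightarrow> secured A s \<Gamma>)"

lemma initial_consistent: "initial \<Gamma> \<Longrightarrow> consistent A \<Gamma>"
  unfolding initial_def consistent_def by (force simp: in_actives)

lemma effect_from:
  assumes "effect \<Gamma> act N" "(C, z) \<in># N"
  shows "ctr_sexps C \<subseteq> act_sexps act \<and> ctr_secrets C \<subseteq> act_secrets act \<or> (\<exists>G. agreed \<Gamma> G C)"
  using assms
proof (induction rule: effect.induct)
  case (3 M Cs ys)
  then have "C \<in># image_mset snd M" by (auto dest: set_zip_leftD)
  then show ?case by force
qed auto

text \<open>A secret of \<open>A\<close> in \<open>C\<close> occurs in \<open>G\<close>, by
  disjointness under the owner \<open>A\<close>; so \<open>A\<close> is a party and has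
  committed.\<close>

lemma agreed_consistent:
  assumes "consistent A \<Gamma>" "agreed \<Gamma> G C"
  shows "(\<forall>e \<in> ctr_sexps C. closed_sexp e) \<and> (\<forall>s \<in> ctr_secrets C \<inter> S A. secured A s \<Gamma>)"
proof -
  obtain o' where o': "TAdv (Adv G o' C) \<in># \<Gamma>" "\<forall>P \<in> pre_parts G. TAuth P (AuCommit (Adv G o' C)) \<in># \<Gamma>"
    using assms(2) unfolding agreed_def by blast
  then have wf: "wf_adv (Adv G o' C)" using assms(1) unfolding consistent_def wf_config_def by force
  moreover have "secured A s \<Gamma>" if s: "s \<in> ctr_secrets C" "s \<in> S A" for s
  proof -
    from s wf have "s \<in> pre_secrets G" by auto
    then obtain g where "g \<in># G" "s \<in> atom_secrets g" by (auto simp: pre_secrets_def)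
    then obtain P where P: "Sec P s \<in># G" by (cases g) auto
    then have "s \<in> S P" using wf by (auto simp: wf_pre_def)
    then have "P = A" using S_disjoint s by blast
    moreover have "P \<in> pre_parts G" using P by (force simp: pre_parts_def)
    ultimately show ?thesis using P o' assms(1) unfolding consistent_def by blast
  qed
  ultimately show ?thesis by auto
qed

lemma cstep_consistent:
  assumes "cstep \<Gamma> l \<Gamma>'" "consistent A \<Gamma>" "A \<in> Hon"
  shows "consistent A \<Gamma>'"
proof -
  have rule: "rule \<Gamma> l \<Gamma>'" and wf: "wf_config \<Gamma>'" "timed \<Gamma>'" using assms by (auto simp: cstep_def)
  have "(\<forall>e \<in> ctr_sexps C. closed_sexp e) \<and> (\<forall>s \<in> ctr_secrets C \<inter> S A. secured A s \<Gamma>)"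
    if C: "(C, z) \<in># actives \<Gamma>'" for C z
  proof -
    \<comment> \<open>Every contract after the step was there before, stems from an agreed
      advertisement, or is a part of the consumed one.\<close>
    consider (old) "(C, z) \<in># actives \<Gamma>" | (new) G where "agreed \<Gamma> G C"
      | (sub) C0 z0 where "(C0, z0) \<in># actives \<Gamma>" "ctr_sexps C \<subseteq> ctr_sexps C0" "ctr_secrets C \<subseteq> ctr_secrets C0"
    proof (cases "activates \<Gamma> \<Gamma>'")
      case True
      then show ?thesis using C old new unfolding activates_def by force
    next
      case False
      then have "consumes \<Gamma> \<Gamma>'" using rule_actives[OF rule] by blast
      then obtain Ps es act Ds x M N where *:
        "actives \<Gamma> = add_mset (Choice (add_mset (Guarded Ps es act) Ds), x) M"
        "actives \<Gamma>' = N + M" "effect \<Gamma> act N"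
        unfolding consumes_def by blast
      show ?thesis
      proof (cases "(C, z) \<in># M")
        case True
        then show ?thesis using old * by simp
      next
        case False
        then have "(C, z) \<in># N" using * C by simp
        from effect_from[OF *(3) this] show ?thesis
        proof
          assume "ctr_sexps C \<subseteq> act_sexps act \<and> ctr_secrets C \<subseteq> act_secrets act"
          then show ?thesis
            using * by (intro sub[of "Choice (add_mset (Guarded Ps es act) Ds)" x]) auto
        qed (use new in blast)
      qed
    qed
    then show ?thesis
    proof cases
      case new
      then show ?thesis using agreed_consistent assms(2) by blast
    qed (use assms(2) in \<open>unfold consistent_def; blast\<close>)+
  qed
  moreover have "secured A s \<Gamma>'" if "TAuth A (AuCommit (Adv G o' C)) \<in># \<Gamma>'" "Sec A s \<in># G" for G o' C s
    using rule_commit[OF rule assms(3) that] rule_secured[OF rule] assms(2) that unfolding consistent_def by blast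
  ultimately show ?thesis using wf rule_secured[OF rule] unfolding consistent_def by blast
qed

lemma run_consistent: "is_run cstep R \<Longrightarrow> consistent A (run_first R) \<Longrightarrow> A \<in> Hon \<Longrightarrow> consistent A (run_last R)"
  by (induction R) (auto intro: cstep_consistent)

section \<open>Terminating contracts by moves of one participant\<close>

text \<open>
  The surviving names keep themselves as origin. This is what makes such runs compose, as names may be
  reused in a configuration after the contract carrying them is gone.
\<close>
definition evolves :: "'p \<Rightarrow> ('p, 'x) config \<Rightarrow> ('p, 'x) config \<Rightarrow> bool" where
  "evolves A \<Gamma> \<Gamma>' \<longleftrightarrow>
     (\<exists>R. is_run cstep R \<and> run_first R = \<Gamma> \<and> run_last R = \<Gamma>' \<and> run_labels R \<subseteq> clabels A \<and>
          (\<forall>z \<in> cn \<Gamma> \<inter> cn \<Gamma>'. orig cn R z = Some z))"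

lemma evolves_refl: "evolves A \<Gamma> \<Gamma>"
  unfolding evolves_def by (rule exI[of _ "Start \<Gamma>"]) simp

lemma evolves_step: "cstep \<Gamma> l \<Gamma>' \<Longrightarrow> l \<in> clabels A \<Longrightarrow> evolves A \<Gamma> \<Gamma>'"
  unfolding evolves_def by (rule exI[of _ "Extend (Start \<Gamma>) l \<Gamma>'"]) simp

text \<open>The last assumption rules out that a name disappears in the first run and returns in the
  second, where its origin would be another contract.\<close>

lemma evolves_trans:
  assumes "evolves A \<Gamma>1 \<Gamma>2" "evolves A \<Gamma>2 \<Gamma>3" "cn \<Gamma>1 \<inter> cn \<Gamma>3 \<subseteq> cn \<Gamma>2"
  shows "evolves A \<Gamma>1 \<Gamma>3"
proof -
  obtain Q R where "is_run cstep Q" "run_first Q = \<Gamma>1" "run_last Q = \<Gamma>2" "run_labels Q \<subseteq> clabels A"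
      "\<forall>z \<in> cn \<Gamma>1 \<inter> cn \<Gamma>2. orig cn Q z = Some z"
    and "is_run cstep R" "run_first R = \<Gamma>2" "run_last R = \<Gamma>3" "run_labels R \<subseteq> clabels A"
      "\<forall>z \<in> cn \<Gamma>2 \<inter> cn \<Gamma>3. orig cn R z = Some z"
    using assms(1,2) unfolding evolves_def by blast
  then show ?thesis
    unfolding evolves_def using assms(3)
    by (intro exI[of _ "run_append Q R"]) (auto simp: orig_append)
qed

lemma evolves_consistent: "evolves A \<Gamma> \<Gamma>' \<Longrightarrow> consistent A \<Gamma> \<Longrightarrow> A \<in> Hon \<Longrightarrow> consistent A \<Gamma>'"
  unfolding evolves_def using run_consistent by blast

lemma run_secured: "is_run cstep R \<Longrightarrow> secured A s (run_first R) \<Longrightarrow> secured A s (run_last R)"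
  by (induction R) (auto simp: cstep_def intro: rule_secured)

section \<open>Making a branch ready to be taken\<close>

definition prepares :: "'p \<Rightarrow> ('p, 'x) config \<Rightarrow> ('p, 'x) config \<Rightarrow> bool" where
  "prepares A \<Gamma> \<Gamma>' \<longleftrightarrow> evolves A \<Gamma> \<Gamma>' \<and> actives \<Gamma>' = actives \<Gamma> \<and>
     (\<forall>T. T \<in># \<Gamma> \<longrightarrow> T \<in># \<Gamma>' \<or> (\<exists>P s N. T = TCommit P s N) \<or> (\<exists>t. T = TTime t))"

lemma prepares_refl: "prepares A \<Gamma> \<Gamma>"
  by (auto simp: prepares_def evolves_refl)

text \<open>The exceptions in \<open>prepares\<close> are the terms that revealing and waiting
  replace. Whatever one preparation achieved thus survives the next, except for the time, which is
  why waiting comes last.\<close>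

lemma prepares_trans: "prepares A \<Gamma>1 \<Gamma>2 \<Longrightarrow> prepares A \<Gamma>2 \<Gamma>3 \<Longrightarrow> prepares A \<Gamma>1 \<Gamma>3"
  unfolding prepares_def using evolves_trans[of A \<Gamma>1 \<Gamma>2 \<Gamma>3] by (auto simp: cn_actives)

lemma prepares_step:
  "cstep \<Gamma> l \<Gamma>' \<Longrightarrow> l \<in> clabels A \<Longrightarrow> actives \<Gamma>' = actives \<Gamma> \<Longrightarrow>
   (\<And>T. T \<in># \<Gamma> \<Longrightarrow> T \<in># \<Gamma>' \<or> (\<exists>P s N. T = TCommit P s N) \<or> (\<exists>t. T = TTime t)) \<Longrightarrow>
   prepares A \<Gamma> \<Gamma>'"
  unfolding prepares_def using evolves_step by blast

lemma prepares_consistent: "prepares A \<Gamma> \<Gamma>' \<Longrightarrow> consistent A \<Gamma> \<Longrightarrow> A \<in> Hon \<Longrightarrow> consistent A \<Gamma>'"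
  unfolding prepares_def using evolves_consistent by blast

lemma wf_config_iff:
  "wf_config \<Gamma> \<longleftrightarrow> (\<forall>T \<in># \<Gamma>. wf_cterm T) \<and> (\<forall>P \<xi>. count \<Gamma> (TAuth P \<xi>) \<le> 1) \<and>
     distinct_mset (held \<Gamma>) \<and> size {#T \<in># \<Gamma>. \<exists>t. T = TTime t#} \<le> 1"
  by (simp add: wf_config_def distinct_mset_def count_held)

lemma prepare_reveal:
  assumes "consistent A \<Gamma>" "secured A s \<Gamma>"
  shows "\<exists>\<Gamma>' N. prepares A \<Gamma> \<Gamma>' \<and> TReveal A s N \<in># \<Gamma>'"
proof (cases "\<exists>N. TReveal A s N \<in># \<Gamma>")
  case False
  then obtain N where "TCommit A s (Some N) \<in># \<Gamma>" using assms unfolding secured_def by blast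
  then obtain \<Gamma>0 where \<Gamma>: "\<Gamma> = add_mset (TCommit A s (Some N)) \<Gamma>0" by (meson multi_member_split)
  have "cstep \<Gamma> (By A (PReveal s)) (add_mset (TReveal A s N) \<Gamma>0)"
    using assms(1) rule.AuthRev unfolding cstep_def consistent_def \<Gamma> by (auto simp: wf_config_iff timed_def)
  then have "prepares A \<Gamma> (add_mset (TReveal A s N) \<Gamma>0)"
    by (rule prepares_step) (auto simp: clabels_def \<Gamma>)
  then show ?thesis by fastforce
qed (use prepares_refl in blast)

lemma prepare_reveals:
  assumes "consistent A \<Gamma>" "A \<in> Hon" "\<And>s. s \<in> set as \<Longrightarrow> secured A s \<Gamma>"
  shows "\<exists>\<Gamma>'. prepares A \<Gamma> \<Gamma>' \<and> (\<forall>s \<in> set as. \<exists>N. TReveal A s N \<in># \<Gamma>')"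
  using assms(3)
proof (induction as)
  case Nil
  then show ?case using prepares_refl by auto
next
  case (Cons s as)
  then obtain \<Gamma>1 where 1: "prepares A \<Gamma> \<Gamma>1" "\<forall>s \<in> set as. \<exists>N. TReveal A s N \<in># \<Gamma>1" by auto
  have "secured A s \<Gamma>" using Cons by simp
  then have "secured A s \<Gamma>1"
    using 1(1) run_secured unfolding prepares_def evolves_def by blast
  then obtain \<Gamma>2 N where 2: "prepares A \<Gamma>1 \<Gamma>2" "TReveal A s N \<in># \<Gamma>2"
    using prepare_reveal prepares_consistent[OF 1(1)] assms by blast
  moreover have "\<exists>N. TReveal A s N \<in># \<Gamma>2" if "s \<in> set as" for s
    using that 1(2) 2(1) unfolding prepares_def by blast
  ultimately show ?case using prepares_trans[OF 1(1)] by auto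
qed

lemma prepare_branch:
  assumes "consistent A \<Gamma>" "TActive (Choice (add_mset D Ds)) v x \<in># \<Gamma>"
    "D = Guarded Ps es act" "set_mset Ps \<subseteq> {A}"
  shows "\<exists>\<Gamma>'. prepares A \<Gamma> \<Gamma>' \<and> (\<forall>P \<in># Ps. TAuth P (AuBranch x D) \<in># \<Gamma>')"
proof (cases "\<forall>P \<in># Ps. TAuth P (AuBranch x D) \<in># \<Gamma>")
  case True
  then show ?thesis using prepares_refl by blast
next
  case False
  \<comment> \<open>\<open>A\<close> is the only decorating participant, so a single authorization
    is missing, and adding it creates no duplicate.\<close>
  then have A: "A \<in># Ps" "TAuth A (AuBranch x D) \<notin># \<Gamma>" using assms(4) by auto
  obtain \<Gamma>0 where \<Gamma>: "\<Gamma> = add_mset (TActive (Choice (add_mset D Ds)) v x) \<Gamma>0"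
    using assms(2) by (meson multi_member_split)
  have wf: "wf_config \<Gamma>" using assms(1) by (simp add: consistent_def)
  then have "wf_contract arity (Choice (add_mset D Ds))"
    unfolding wf_config_iff \<Gamma> by simp
  then have "wf_guarded arity D" by (cases rule: wf_contract.cases) auto
  then have "wf_config (add_mset (TAuth A (AuBranch x D)) \<Gamma>)"
    using wf A(2) by (auto simp: wf_config_iff not_in_iff)
  then have "cstep \<Gamma> (By A (PBranch x D)) (add_mset (TAuth A (AuBranch x D)) \<Gamma>)"
    using rule.AuthBranch[OF \<Gamma> assms(3) A(1)] assms(1)
    unfolding cstep_def consistent_def timed_def by auto
  then have "prepares A \<Gamma> (add_mset (TAuth A (AuBranch x D)) \<Gamma>)"
    by (rule prepares_step) (auto simp: clabels_def)
  then show ?thesis using assms(4) by (intro exI conjI) auto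
qed

lemma prepare_delay:
  assumes "consistent A \<Gamma>"
  shows "\<exists>\<Gamma>' t. prepares A \<Gamma> \<Gamma>' \<and> TTime t \<in># \<Gamma>' \<and> u \<le> t"
proof -
  obtain t0 where "TTime t0 \<in># \<Gamma>" using assms unfolding consistent_def timed_def by blast
  then obtain \<Gamma>0 where \<Gamma>: "\<Gamma> = add_mset (TTime t0) \<Gamma>0" by (meson multi_member_split)
  \<comment> \<open>The maximum with 1 is taken because a delay must be positive even when the time
    has already come.\<close>
  define \<delta> where "\<delta> = max 1 (u - t0)"
  have "cstep \<Gamma> (Delay \<delta>) (add_mset (TTime (t0 + \<delta>)) \<Gamma>0)"
    using assms rule.DelayC[of \<delta> t0 \<Gamma>0] unfolding cstep_def consistent_def \<Gamma> \<delta>_def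
    by (auto simp: wf_config_iff timed_def)
  then have "prepares A \<Gamma> (add_mset (TTime (t0 + \<delta>)) \<Gamma>0)"
    by (rule prepares_step) (auto simp: clabels_def \<Gamma>)
  then show ?thesis by (intro exI[of _ "add_mset (TTime (t0 + \<delta>)) \<Gamma>0"] exI[of _ "t0 + \<delta>"]) (auto simp: \<delta>_def)
qed

text \<open>Brings the configuration into the literal form of the left-hand side of
  \<open>Branch\<close>, with the revealed secrets split off for \<open>RevC\<close>.\<close>

lemma prepare:
  assumes "consistent A \<Gamma>" "A \<in> Hon" "(Choice (add_mset D Ds), x) \<in># actives \<Gamma>"
    "D = Guarded Ps es act" "set_mset Ps \<subseteq> {A}"
    "distinct as" "\<And>s. s \<in> set as \<Longrightarrow> secured A s \<Gamma>"
  obtains \<Gamma>' v t N \<Gamma>0 where "evolves A \<Gamma> \<Gamma>'" "actives \<Gamma>' = actives \<Gamma>" "\<forall>e \<in># es. sval e \<le> t"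
    "\<Gamma>' = add_mset (TActive (Choice (add_mset D Ds)) v x)
       ({#TAuth P (AuBranch x D). P \<in># mset_set (set_mset Ps)#} +
        add_mset (TTime t) (mset (map (\<lambda>s. TReveal A s (N s)) as) + \<Gamma>0))"
proof -
  obtain v where v: "TActive (Choice (add_mset D Ds)) v x \<in># \<Gamma>" using assms by (auto simp: in_actives)
  obtain \<Gamma>1 where 1: "prepares A \<Gamma> \<Gamma>1" "\<forall>s \<in> set as. \<exists>N. TReveal A s N \<in># \<Gamma>1"
    using prepare_reveals assms by metis
  have v1: "TActive (Choice (add_mset D Ds)) v x \<in># \<Gamma>1" and i1: "consistent A \<Gamma>1"
    using v 1(1) prepares_consistent[OF 1(1) assms(1,2)] unfolding prepares_def by blast+
  obtain \<Gamma>2 where 2: "prepares A \<Gamma>1 \<Gamma>2" "\<forall>P \<in># Ps. TAuth P (AuBranch x D) \<in># \<Gamma>2"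
    using prepare_branch[OF i1 v1 assms(4,5)] by blast
  have i2: "consistent A \<Gamma>2" using prepares_consistent[OF 2(1) i1 assms(2)] .
  \<comment> \<open>Inserting 0 keeps the maximum defined when there are no time
    constraints.\<close>
  obtain \<Gamma>3 t where 3: "prepares A \<Gamma>2 \<Gamma>3" "TTime t \<in># \<Gamma>3" "Max (insert 0 (sval ` set_mset es)) \<le> t"
    using prepare_delay[OF i2] by blast
  obtain N where N: "\<forall>s \<in> set as. TReveal A s (N s) \<in># \<Gamma>1" using 1(2) by metis
  have p13: "prepares A \<Gamma>1 \<Gamma>3" using prepares_trans 2 3 by blast
  let ?M = "add_mset (TActive (Choice (add_mset D Ds)) v x)
       ({#TAuth P (AuBranch x D). P \<in># mset_set (set_mset Ps)#} +
        add_mset (TTime t) (mset (map (\<lambda>s. TReveal A s (N s)) as)))"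
  have "?M \<subseteq># \<Gamma>3"
  proof (rule distinct_mset_subset)
    have "distinct_mset {#TAuth P (AuBranch x D). P \<in># mset_set (set_mset Ps)#}"
      using assms(5) by (cases "set_mset Ps = {}") (auto dest: subset_singletonD)
    moreover have "distinct (map (\<lambda>s. TReveal A s (N s)) as)"
      using assms(6) by (simp add: distinct_map inj_on_def)
    ultimately show "distinct_mset ?M"
      unfolding distinct_mset_simps distinct_mset_union distinct_mset_mset by auto
    have "TActive (Choice (add_mset D Ds)) v x \<in># \<Gamma>3" "\<forall>s \<in> set as. TReveal A s (N s) \<in># \<Gamma>3"
      using v1 N p13 unfolding prepares_def by blast+
    moreover have "\<forall>P \<in># Ps. TAuth P (AuBranch x D) \<in># \<Gamma>3"
      using 2(2) 3(1) unfolding prepares_def by blast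
    ultimately show "set_mset ?M \<subseteq> set_mset \<Gamma>3" using 3(2) by auto
  qed
  then obtain \<Gamma>0 where "\<Gamma>3 = ?M + \<Gamma>0" by (metis subset_mset.le_iff_add)
  moreover have "prepares A \<Gamma> \<Gamma>3" using prepares_trans 1(1) p13 by blast
  moreover have "\<forall>e \<in># es. sval e \<le> t" using 3(3) by simp
  ultimately show ?thesis using that[of \<Gamma>3 t v N \<Gamma>0] unfolding prepares_def by simp
qed

section \<open>Taking a prepared branch\<close>

lemma branch_evolves:
  assumes "consistent A \<Gamma>" "D = Guarded Ps es act" "\<forall>e \<in># es. sval e \<le> t"
    "\<Gamma> = add_mset (TActive (Choice (add_mset D Ds)) v x)
       ({#TAuth P (AuBranch x D). P \<in># mset_set (set_mset Ps)#} + add_mset (TTime t) \<Gamma>0)"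
    "rule (add_mset (TActive (Choice {#Guarded {#} {#} act#}) v x) \<Gamma>0) l (N + \<Gamma>0)" "l \<in> clabels A"
    "\<And>T. T \<in># N \<Longrightarrow> wf_cterm T \<and> held_term T \<noteq> {#}"
    "distinct_mset (held N)" "set_mset (held N) \<inter> names \<Gamma> = {}"
  shows "evolves A \<Gamma> (add_mset (TTime t) (N + \<Gamma>0))"
proof (rule evolves_step)
  have wf: "wf_config \<Gamma>" using assms(1) by (simp add: consistent_def)
  have x: "x \<notin># held \<Gamma>0" "x \<notin># held N"
    using wf assms(9) unfolding wf_config_iff assms(4) by (auto simp: distinct_mset_union)
  have "x \<notin> set_mset (held (N + \<Gamma>0))" using x by simp
  then have "x \<notin> cn (N + \<Gamma>0)" using cn_subset_held by blast
  moreover have "closed_sexp e" if "e \<in># es" for e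
  proof -
    have "e \<in> ctr_sexps (Choice (add_mset D Ds))" using that assms(2) by simp
    moreover have "(Choice (add_mset D Ds), x) \<in># actives \<Gamma>" using assms(4) by simp
    ultimately show ?thesis using assms(1) unfolding consistent_def by blast
  qed
  ultimately have "rule \<Gamma> l (add_mset (TTime t) (N + \<Gamma>0))"
    unfolding assms(4) using assms(2,3,5) by (intro rule.Branch) auto
  \<comment> \<open>Each term of \<open>N\<close> holds a name, so it is neither an authorization
    nor a time term, and these names are new to the configuration.\<close>
  moreover have "wf_config (add_mset (TTime t) (N + \<Gamma>0))"
  proof -
    have auth: "count N (TAuth P \<xi>) = 0" for P \<xi>
      using assms(7)[of "TAuth P \<xi>"] by (auto simp flip: not_in_iff)
    have time: "{#T \<in># N. \<exists>t. T = TTime t#} = filter_mset (\<lambda>_. False) N"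
      using assms(7) by (intro filter_mset_cong) force+
    have "set_mset (held N) \<inter> set_mset (held \<Gamma>0) = {}"
      using assms(9) held_names[of \<Gamma>0] unfolding assms(4) by auto
    moreover have "count \<Gamma>0 (TAuth P \<xi>) \<le> count \<Gamma> (TAuth P \<xi>)" for P \<xi>
      unfolding assms(4) by simp
    then have "\<forall>P \<xi>. count \<Gamma>0 (TAuth P \<xi>) \<le> 1" using wf unfolding wf_config_iff by (meson le_trans)
    moreover have "\<forall>T \<in># \<Gamma>0. wf_cterm T" "distinct_mset (held \<Gamma>0)" "size {#T \<in># \<Gamma>0. \<exists>t. T = TTime t#} = 0"
      using wf unfolding wf_config_iff assms(4) by (auto simp: distinct_mset_union)
    ultimately show ?thesis
      unfolding wf_config_iff using assms(7,8) auth time by (auto simp: distinct_mset_union)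
  qed
  ultimately show "cstep \<Gamma> l (add_mset (TTime t) (N + \<Gamma>0))"
    using assms(1) by (auto simp: cstep_def consistent_def timed_def)
qed fact

lemma active_wf_action:
  assumes "wf_config \<Gamma>" "(Choice (add_mset (Guarded Ps es act) Ds), x) \<in># actives \<Gamma>"
  shows "wf_action arity act"
proof -
  obtain v where "TActive (Choice (add_mset (Guarded Ps es act) Ds)) v x \<in># \<Gamma>"
    using assms(2) by (auto simp: in_actives)
  then have "wf_contract arity (Choice (add_mset (Guarded Ps es act) Ds))"
    using assms(1) unfolding wf_config_def by force
  then have "wf_guarded arity (Guarded Ps es act)" by (cases rule: wf_contract.cases) auto
  then show ?thesis by (cases rule: wf_guarded.cases) auto
qed

text \<open>The common frame of the three moves below; only the rule for the bare action has to be
  supplied. \<open>X\<close> becomes the set of all names in use before the branch, and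
  \<open>Q\<close> describes the resulting contracts.\<close>

lemma branch_move:
  assumes "consistent A \<Gamma>" "A \<in> Hon" "(C, x) \<in># actives \<Gamma>"
    "C = Choice (add_mset (Guarded Ps es act) Ds)" "set_mset Ps \<subseteq> {A}"
    "distinct as" "\<And>s. s \<in> set as \<Longrightarrow> secured A s \<Gamma>"
    and move: "\<And>v N \<Gamma>0 X. 0 \<le> v \<Longrightarrow> finite X \<Longrightarrow>
      names (add_mset (TActive (Choice {#Guarded {#} {#} act#}) v x)
        (mset (map (\<lambda>s. TReveal A s (N s)) as) + \<Gamma>0)) \<subseteq> X \<Longrightarrow>
      \<exists>l M. rule (add_mset (TActive (Choice {#Guarded {#} {#} act#}) v x)
          (mset (map (\<lambda>s. TReveal A s (N s)) as) + \<Gamma>0)) l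
          (M + (mset (map (\<lambda>s. TReveal A s (N s)) as) + \<Gamma>0)) \<and>
        l \<in> clabels A \<and> (\<forall>T \<in># M. wf_cterm T \<and> held_term T \<noteq> {#}) \<and>
        distinct_mset (held M) \<and> set_mset (held M) \<inter> X = {} \<and> Q (actives M)"
  shows "\<exists>\<Gamma>' N. evolves A \<Gamma> \<Gamma>' \<and> actives \<Gamma>' = N + (actives \<Gamma> - {#(C, x)#}) \<and> Q N"
proof -
  let ?D = "Guarded Ps es act"
  obtain \<Gamma>1 v t N \<Gamma>0 where 1: "evolves A \<Gamma> \<Gamma>1" "actives \<Gamma>1 = actives \<Gamma>" "\<forall>e \<in># es. sval e \<le> t"
    "\<Gamma>1 = add_mset (TActive (Choice (add_mset ?D Ds)) v x)
       ({#TAuth P (AuBranch x ?D). P \<in># mset_set (set_mset Ps)#} +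
        add_mset (TTime t) (mset (map (\<lambda>s. TReveal A s (N s)) as) + \<Gamma>0))"
    using assms(3) unfolding assms(4) by (rule prepare[OF assms(1,2) _ refl assms(5,6,7)])
  let ?\<Delta> = "mset (map (\<lambda>s. TReveal A s (N s)) as) + \<Gamma>0"
  have c1: "consistent A \<Gamma>1" using evolves_consistent[OF 1(1)] assms(1,2) by blast
  then have "wf_config \<Gamma>1" by (simp add: consistent_def)
  then have "0 \<le> v" unfolding wf_config_def 1(4) by simp
  moreover have "names (add_mset (TActive (Choice {#Guarded {#} {#} act#}) v x) ?\<Delta>) \<subseteq> names \<Gamma>1"
    unfolding 1(4) by auto
  ultimately obtain l M where *:
    "rule (add_mset (TActive (Choice {#Guarded {#} {#} act#}) v x) ?\<Delta>) l (M + ?\<Delta>) \<and>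
      l \<in> clabels A \<and> (\<forall>T \<in># M. wf_cterm T \<and> held_term T \<noteq> {#}) \<and>
      distinct_mset (held M) \<and> set_mset (held M) \<inter> names \<Gamma>1 = {} \<and> Q (actives M)"
    by (rule move[OF _ finite_names, THEN exE], elim exE) (rule that)
  then have M: "rule (add_mset (TActive (Choice {#Guarded {#} {#} act#}) v x) ?\<Delta>) l (M + ?\<Delta>)"
    "l \<in> clabels A" "\<And>T. T \<in># M \<Longrightarrow> wf_cterm T \<and> held_term T \<noteq> {#}" "distinct_mset (held M)"
    "set_mset (held M) \<inter> names \<Gamma>1 = {}" "Q (actives M)"
    by simp_all
  have "evolves A \<Gamma>1 (add_mset (TTime t) (M + ?\<Delta>))"
    using branch_evolves[OF c1 refl 1(3,4) M(1-5)] .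
  moreover have "cn \<Gamma>1 = cn \<Gamma>" by (simp add: cn_actives 1(2))
  ultimately have "evolves A \<Gamma> (add_mset (TTime t) (M + ?\<Delta>))"
    using evolves_trans[OF 1(1)] by blast
  moreover have "actives (add_mset (TTime t) (M + ?\<Delta>)) = actives M + (actives \<Gamma>1 - {#(C, x)#})"
    unfolding 1(4) assms(4) by simp
  ultimately show ?thesis using M(6) 1(2) by metis
qed

section \<open>Moves of one participant: withdrawing, revealing, splitting\<close>

lemma withdraw_move:
  assumes "consistent A \<Gamma>" "A \<in> Hon" "(C, x) \<in># actives \<Gamma>"
    "C = Choice (add_mset (Guarded Ps es (Withdraw P)) Ds)" "set_mset Ps \<subseteq> {A}"
  shows "\<exists>\<Gamma>'. evolves A \<Gamma> \<Gamma>' \<and> actives \<Gamma>' = actives \<Gamma> - {#(C, x)#}"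
proof -
  have "\<exists>\<Gamma>' N. evolves A \<Gamma> \<Gamma>' \<and> actives \<Gamma>' = N + (actives \<Gamma> - {#(C, x)#}) \<and> N = {#}"
  proof (rule branch_move[OF assms, of "[]"])
    fix v :: rat and N :: "secret \<Rightarrow> nat" and \<Gamma>0 :: "('p, 'x) config" and X
    assume "0 \<le> v" "finite X"
      and X: "names (add_mset (TActive (Choice {#Guarded {#} {#} (Withdraw P)#}) v x)
        (mset (map (\<lambda>s. TReveal A s (N s)) []) + \<Gamma>0)) \<subseteq> X"
    obtain ys where "length ys = 1" "distinct ys" "set ys \<inter> X = {}"
      using fresh_names[OF \<open>finite X\<close>] .
    then obtain y where "y \<notin> X" by (cases ys) auto
    with X have "rule (add_mset (TActive (Choice {#Guarded {#} {#} (Withdraw P)#}) v x) \<Gamma>0)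
        (DoWithdraw P v x) (add_mset (TDep P v y) \<Gamma>0)"
      by (intro rule.WithdrawC) auto
    then show "\<exists>l M. rule (add_mset (TActive (Choice {#Guarded {#} {#} (Withdraw P)#}) v x)
          (mset (map (\<lambda>s. TReveal A s (N s)) []) + \<Gamma>0)) l
          (M + (mset (map (\<lambda>s. TReveal A s (N s)) []) + \<Gamma>0)) \<and>
        l \<in> clabels A \<and> (\<forall>T \<in># M. wf_cterm T \<and> held_term T \<noteq> {#}) \<and>
        distinct_mset (held M) \<and> set_mset (held M) \<inter> X = {} \<and> actives M = {#}"
      using \<open>0 \<le> v\<close> \<open>y \<notin> X\<close>
      by (intro exI[of _ "DoWithdraw P v x"] exI[of _ "{#TDep P v y#}"]) (auto simp: clabels_def)
  qed auto
  then show ?thesis by auto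
qed

text \<open>\<open>A\<close> owns all the secrets, so she can reveal them alone, and
  \<open>PTrue\<close> holds whatever their values are.\<close>

lemma reveal_move:
  assumes "consistent A \<Gamma>" "A \<in> Hon" "(C, x) \<in># actives \<Gamma>"
    "C = Choice (add_mset (Guarded Ps es (Reveal as PTrue C')) Ds)" "set_mset Ps \<subseteq> {A}"
    "set as \<subseteq> S A"
  shows "\<exists>\<Gamma>' y. evolves A \<Gamma> \<Gamma>' \<and> actives \<Gamma>' = add_mset (C', y) (actives \<Gamma> - {#(C, x)#})"
proof -
  have "wf_action arity (Reveal as PTrue C')"
    using active_wf_action assms(1,3,4) unfolding consistent_def by blast
  then have wf: "wf_contract arity C'" "distinct as" by (auto elim: wf_action.cases)
  have "secured A s \<Gamma>" if "s \<in> set as" for s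
  proof -
    have "s \<in> ctr_secrets C \<inter> S A" using that assms(4,6) by auto
    then show ?thesis using assms(1,3) unfolding consistent_def by blast
  qed
  note sec = this
  have "\<exists>\<Gamma>' N. evolves A \<Gamma> \<Gamma>' \<and> actives \<Gamma>' = N + (actives \<Gamma> - {#(C, x)#}) \<and> (\<exists>y. N = {#(C', y)#})"
  proof (rule branch_move[OF assms(1-5) wf(2) sec])
    fix v :: rat and N :: "secret \<Rightarrow> nat" and \<Gamma>0 :: "('p, 'x) config" and X
    assume "0 \<le> v" "finite X"
      and X: "names (add_mset (TActive (Choice {#Guarded {#} {#} (Reveal as PTrue C')#}) v x)
        (mset (map (\<lambda>s. TReveal A s (N s)) as) + \<Gamma>0)) \<subseteq> X"
    obtain ys where "length ys = 1" "distinct ys" "set ys \<inter> X = {}"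
      using fresh_names[OF \<open>finite X\<close>] .
    then obtain y where y: "y \<notin> X" by (cases ys) auto
    have "rule (add_mset (TActive (Choice {#Guarded {#} {#} (Reveal as PTrue C')#}) v x)
          (mset (map (\<lambda>s. TReveal A s (N s)) as) + \<Gamma>0)) (DoReveal as y)
        (add_mset (TActive C' v y) (mset (map (\<lambda>s. TReveal A s (N s)) as) + \<Gamma>0))"
      using X y by (intro rule.RevC[OF refl refl]) auto
    then show "\<exists>l M. rule (add_mset (TActive (Choice {#Guarded {#} {#} (Reveal as PTrue C')#}) v x)
          (mset (map (\<lambda>s. TReveal A s (N s)) as) + \<Gamma>0)) l
          (M + (mset (map (\<lambda>s. TReveal A s (N s)) as) + \<Gamma>0)) \<and>
        l \<in> clabels A \<and> (\<forall>T \<in># M. wf_cterm T \<and> held_term T \<noteq> {#}) \<and>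
        distinct_mset (held M) \<and> set_mset (held M) \<inter> X = {} \<and> (\<exists>y. actives M = {#(C', y)#})"
      using \<open>0 \<le> v\<close> y wf
      by (intro exI[of _ "DoReveal as y"] exI[of _ "{#TActive C' v y#}"]) (auto simp: clabels_def)
  qed
  then show ?thesis by auto
qed

lemma held_map2_split:
  "length ys = length bs \<Longrightarrow>
   held (mset (map2 (\<lambda>(w', C) y. TActive C (v * w' / w) y) bs ys)) = mset ys"
  by (induction ys bs rule: list_induct2) auto

lemma split_move:
  assumes "consistent A \<Gamma>" "A \<in> Hon" "(C, x) \<in># actives \<Gamma>"
    "C = Choice (add_mset (Guarded Ps es (Split (mset bs))) Ds)" "set_mset Ps \<subseteq> {A}"
  shows "\<exists>\<Gamma>' ys. length ys = length bs \<and> evolves A \<Gamma> \<Gamma>' \<and>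
    actives \<Gamma>' = mset (zip (map snd bs) ys) + (actives \<Gamma> - {#(C, x)#})"
proof -
  have "wf_action arity (Split (mset bs))"
    using active_wf_action assms(1,3,4) unfolding consistent_def by blast
  then have wf: "\<forall>b \<in> set bs. 0 \<le> fst b \<and> wf_contract arity (snd b)"
    by (cases rule: wf_action.cases) auto
  define w where "w = sum_list (map fst bs)"
  \<comment> \<open>This is enough for the new balances: if all weights are 0, the quotients are 0
    as well.\<close>
  have "0 \<le> w" unfolding w_def using wf by (intro sum_list_nonneg) auto
  have "\<exists>\<Gamma>' N. evolves A \<Gamma> \<Gamma>' \<and> actives \<Gamma>' = N + (actives \<Gamma> - {#(C, x)#}) \<and>
      (\<exists>ys. length ys = length bs \<and> N = mset (zip (map snd bs) ys))"
  proof (rule branch_move[OF assms, of "[]"])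
    fix v :: rat and N :: "secret \<Rightarrow> nat" and \<Gamma>0 :: "('p, 'x) config" and X
    assume "0 \<le> v" "finite X"
      and X: "names (add_mset (TActive (Choice {#Guarded {#} {#} (Split (mset bs))#}) v x)
        (mset (map (\<lambda>s. TReveal A s (N s)) []) + \<Gamma>0)) \<subseteq> X"
    obtain ys where ys: "length ys = length bs" "distinct ys" "set ys \<inter> X = {}"
      using fresh_names[OF \<open>finite X\<close>] .
    let ?M = "mset (map2 (\<lambda>(w', C) y. TActive C (v * w' / w) y) bs ys)"
    have "rule (add_mset (TActive (Choice {#Guarded {#} {#} (Split (mset bs))#}) v x) \<Gamma>0)
        (DoSplit x) (?M + \<Gamma>0)"
      using X ys by (intro rule.SplitC[OF refl w_def]) auto
    moreover have "\<forall>T \<in># ?M. wf_cterm T \<and> held_term T \<noteq> {#}"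
      using wf \<open>0 \<le> v\<close> \<open>0 \<le> w\<close> by (force dest: set_zip_leftD)
    ultimately show "\<exists>l M. rule (add_mset (TActive (Choice {#Guarded {#} {#} (Split (mset bs))#}) v x)
          (mset (map (\<lambda>s. TReveal A s (N s)) []) + \<Gamma>0)) l
          (M + (mset (map (\<lambda>s. TReveal A s (N s)) []) + \<Gamma>0)) \<and>
        l \<in> clabels A \<and> (\<forall>T \<in># M. wf_cterm T \<and> held_term T \<noteq> {#}) \<and>
        distinct_mset (held M) \<and> set_mset (held M) \<inter> X = {} \<and>
        (\<exists>ys. length ys = length bs \<and> actives M = mset (zip (map snd bs) ys))"
      using ys held_map2_split[OF ys(1)] actives_map2_split[OF ys(1)]
      by (intro exI[of _ "DoSplit x"] exI[of _ ?M]) (simp add: clabels_def del: mset_map, blast)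
  qed auto
  then show ?thesis by auto
qed

text \<open>The assumption ranges over all consistent configurations still containing the contract,
  since terminating one component changes the configuration for the others.\<close>

lemma evolves_each:
  assumes "A \<in> Hon" "consistent A \<Gamma>" "actives \<Gamma> = mset Cs + M"
    "\<And>C y \<Gamma>. (C, y) \<in> set Cs \<Longrightarrow> consistent A \<Gamma> \<Longrightarrow> (C, y) \<in># actives \<Gamma> \<Longrightarrow>
      \<exists>\<Gamma>'. evolves A \<Gamma> \<Gamma>' \<and> actives \<Gamma>' = actives \<Gamma> - {#(C, y)#}"
  shows "\<exists>\<Gamma>'. evolves A \<Gamma> \<Gamma>' \<and> actives \<Gamma>' = M"
  using assms(2-)
proof (induction Cs arbitrary: \<Gamma>)
  case Nil
  then show ?case using evolves_refl by auto
next
  case (Cons p Cs)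
  obtain C y where p: "p = (C, y)" by (cases p)
  then obtain \<Gamma>1 where 1: "evolves A \<Gamma> \<Gamma>1" "actives \<Gamma>1 = mset Cs + M"
    using Cons.prems(3)[of C y \<Gamma>] Cons.prems(1,2) by auto
  then have "consistent A \<Gamma>1" using evolves_consistent Cons.prems(1) assms(1) by blast
  then obtain \<Gamma>2 where 2: "evolves A \<Gamma>1 \<Gamma>2" "actives \<Gamma>2 = M"
    using Cons.IH 1(2) Cons.prems(3) by (metis list.set_intros(2))
  then show ?case using evolves_trans[OF 1(1) 2(1)] 1(2) by (auto simp: cn_actives)
qed

text \<open>Both a decoration by another participant and a starred action would show up as a
  star.\<close>

lemma abs_guarded_unstarred:
  assumes "abs_guarded S A D = K" "\<And>K'. K \<noteq> AStar K'"
  obtains Ps es act where "D = Guarded Ps es act" "set_mset Ps \<subseteq> {A}" "abs_action S A act = K"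
proof -
  obtain Ps es act where D: "D = Guarded Ps es act" by (cases D)
  have "set_mset Ps \<subseteq> {A} \<and> abs_action S A act = K"
    using assms unfolding D by (auto simp: astar_def split: if_splits aguarded.splits)
  then show ?thesis using that D by blast
qed

lemma killable_evolves:
  assumes "killable K" "A \<in> Hon" "consistent A \<Gamma>" "(C, y) \<in># actives \<Gamma>" "abs_contract S A C = K"
  shows "\<exists>\<Gamma>'. evolves A \<Gamma> \<Gamma>' \<and> actives \<Gamma>' = actives \<Gamma> - {#(C, y)#}"
  using assms(1,3-)
proof (induction arbitrary: \<Gamma> C y rule: killable.induct)
  have branch: "\<exists>D Ds. C = Choice (add_mset D Ds) \<and> abs_guarded S A D = K"
    if *: "abs_contract S A C = AChoice Ks" "K \<in># Ks" for C :: "('p, 'x) ctr" and K Ks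
  proof -
    obtain Ds where C: "C = Choice Ds" by (cases C)
    then obtain D where D: "D \<in># Ds" "abs_guarded S A D = K" using * by auto
    then obtain Ds' where "Ds = add_mset D Ds'" by (meson multi_member_split)
    then show ?thesis using C D by blast
  qed
  {
    case (1 P Ks)
    then obtain D Ds where C: "C = Choice (add_mset D Ds)" and "abs_guarded S A D = AWithdraw P"
      using branch by blast
    then obtain Ps es act where D: "D = Guarded Ps es act" "set_mset Ps \<subseteq> {A}"
      and "abs_action S A act = AWithdraw P"
      by (elim abs_guarded_unstarred) auto
    then have "act = Withdraw P" by (cases act) (auto split: if_splits)
    then show ?case using withdraw_move[OF 1(2) assms(2) 1(3) _ D(2)] C D(1) by blast
  next
    case (2 K Ks)
    then obtain D Ds where C: "C = Choice (add_mset D Ds)" and "abs_guarded S A D = ATau K"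
      using branch by blast
    then obtain Ps es act where D: "D = Guarded Ps es act" "set_mset Ps \<subseteq> {A}"
      and "abs_action S A act = ATau K"
      by (elim abs_guarded_unstarred) auto
    then obtain as C' where act: "act = Reveal as PTrue C'" "set as \<subseteq> S A" "abs_contract S A C' = K"
      by (cases act) (auto split: if_splits)
    obtain \<Gamma>1 z where 1: "evolves A \<Gamma> \<Gamma>1" "actives \<Gamma>1 = add_mset (C', z) (actives \<Gamma> - {#(C, y)#})"
      using reveal_move[OF 2(4) assms(2) 2(5) _ D(2) act(2)] C D(1) act(1) by blast
    then have "consistent A \<Gamma>1" using evolves_consistent 2(4) assms(2) by blast
    then obtain \<Gamma>2 where 2: "evolves A \<Gamma>1 \<Gamma>2" "actives \<Gamma>2 = actives \<Gamma> - {#(C, y)#}"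
      using 2(3)[of \<Gamma>1 C' z] 1(2) act(3) by auto
    then show ?case using evolves_trans[OF 1(1) 2(1)] 1(2) by (auto simp: cn_actives)
  next
    case (3 Ks' Ks)
    then obtain D Ds where C: "C = Choice (add_mset D Ds)" and "abs_guarded S A D = ASplit Ks'"
      using branch by blast
    then obtain Ps es act where D: "D = Guarded Ps es act" "set_mset Ps \<subseteq> {A}"
      and "abs_action S A act = ASplit Ks'"
      by (elim abs_guarded_unstarred) auto
    then obtain Ms where act: "act = Split Ms"
      and Ks': "Ks' = image_mset snd (image_mset (map_prod id (abs_contract S A)) Ms)"
      by (cases act) (auto split: if_splits)
    obtain bs where bs: "Ms = mset bs" by (metis ex_mset)
    obtain \<Gamma>1 ys where 1: "length ys = length bs" "evolves A \<Gamma> \<Gamma>1"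
      "actives \<Gamma>1 = mset (zip (map snd bs) ys) + (actives \<Gamma> - {#(C, y)#})"
      using split_move[OF 3(4) assms(2) 3(5) _ D(2)] C D(1) act bs by blast
    then have "consistent A \<Gamma>1" using evolves_consistent 3(4) assms(2) by blast
    then obtain \<Gamma>2 where 2: "evolves A \<Gamma>1 \<Gamma>2" "actives \<Gamma>2 = actives \<Gamma> - {#(C, y)#}"
    proof (rule evolves_each[OF assms(2) _ 1(3), THEN exE], goal_cases)
      case (1 C' z \<Gamma>')
      then have "C' \<in> snd ` set bs" by (auto dest: set_zip_leftD)
      then have "abs_contract S A C' \<in># Ks'" unfolding Ks' bs by force
      \<comment> \<open>The induction hypothesis holds for every name and every consistent
        configuration, so the names produced by the split do not matter.\<close>
      then show ?case using 3(3) 1 by blast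
    qed blast
    then show ?case using evolves_trans[OF 1(2) 2(1)] 1(3) by (auto simp: cn_actives)
  }
qed

text \<open>The final contract names are old names other than \<open>y\<close>, and each of them is
  its own origin; hence none descends from \<open>y\<close>.\<close>

lemma killable_liquidable:
  assumes "killable (abs_contract S A C)" "A \<in> Hon" "consistent A \<Gamma>" "(C, y) \<in># actives \<Gamma>"
  shows "liquidable cstep cn (clabels A) \<Gamma> y"
proof -
  obtain \<Gamma>' where \<Gamma>': "evolves A \<Gamma> \<Gamma>'" "actives \<Gamma>' = actives \<Gamma> - {#(C, y)#}"
    using killable_evolves assms by blast
  have "distinct_mset (image_mset snd (actives \<Gamma>))"
    using assms(3) wf_distinct_actives by (simp add: consistent_def)
  then obtain M where "actives \<Gamma> = add_mset (C, y) M" "y \<notin> snd ` set_mset M"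
    using assms(4) by (auto dest!: multi_member_split)
  with \<Gamma>'(2) have "cn \<Gamma>' \<subseteq> cn \<Gamma>" "y \<notin> cn \<Gamma>'" by (auto simp: cn_actives)
  then show ?thesis
    using \<Gamma>'(1) unfolding evolves_def liquidable_def by (metis IntI option.inject subsetD)
qed

lemma reachable_consistent: "reachable \<Gamma> \<Longrightarrow> A \<in> Hon \<Longrightarrow> consistent A \<Gamma>"
  unfolding reachable_def using initial_consistent run_consistent by blast

lemma abstract_liquid_imp_liquid:
  assumes "A \<in> Hon" "reachable \<Gamma>" "x \<in> \<X>" "\<X> \<subseteq> cn \<Gamma>"
    "liquid (astep A) acn alabels (abs_config S A \<X> \<Gamma>) x"
  shows "liquid cstep cn (clabels A) \<Gamma> x"
  unfolding liquid_def
proof (intro allI impI, elim conjE)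
  fix R y
  assume R: "is_run cstep R" "run_first R = \<Gamma>" and y: "orig cn R y = Some x"
  let ?Y = "{z. \<exists>w \<in> \<X>. orig cn R z = Some w}"
  have c: "consistent A \<Gamma>" using reachable_consistent assms by blast
  then have cR: "consistent A (run_last R)" using run_consistent R assms(1) by blast
  then have wf: "wf_config \<Gamma>" "wf_config (run_last R)" using c by (auto simp: consistent_def)
  obtain R' Xs where R': "is_run (astep A) R'" "run_first R' = abs_config S A \<X> \<Gamma>"
    "run_last R' = abs_config S A ?Y (run_last R) + image_mset ARec Xs"
    "orig acn R' y = Some x"
    using abstract_run[OF R(1), of \<X> A] R(2) assms(3,4) wf(1) y by blast
  then have "liquidable (astep A) acn alabels (run_last R') y"
    using assms(5) unfolding liquid_def by blast
  moreover obtain C where C: "(C, y) \<in># actives (run_last R)"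
    using orig_in_last[OF y] by (auto simp: cn_actives)
  \<comment> \<open>The origin of \<open>y\<close> lies in \<X>, so its contract is among those kept
    by the abstraction.\<close>
  moreover have "AActive (abs_contract S A C) y \<in># run_last R'"
    using C y assms(3) unfolding R'(3) abs_config_actives abs_actives_def by force
  moreover have "distinct_mset (anames (run_last R'))"
  proof -
    \<comment> \<open>Abstract configurations may carry a name twice; here this is excluded by
      well-formedness of the concrete configuration.\<close>
    have "image_mset snd {#(C, z) \<in># actives (run_last R). z \<in> ?Y#} \<subseteq># image_mset snd (actives (run_last R))"
      by (intro image_mset_subseteq_mono multiset_filter_subset)
    then show ?thesis
      using distinct_mset_mono wf_distinct_actives[OF wf(2)] unfolding R'(3) abs_config_actives by simp
  qed
  ultimately have "killable (abs_contract S A C)" using liquidable_killable by blast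
  then show "liquidable cstep cn (clabels A) (run_last R) y"
    using killable_liquidable assms(1) cR C by blast
qed

end

theorem theorem5p7:
  fixes Hon :: "'p set"
    and S :: "'p \<Rightarrow> secret set"
    and params :: "'x::finite \<Rightarrow> intvar list"
    and pre :: "'x \<Rightarrow> 'p precond"
    and body :: "'x \<Rightarrow> ('p, 'x) ctr"
    and A :: 'p
    and \<Gamma> :: "('p, 'x) config"
    and \<X> :: "name set"
    and x :: name
  assumes "bitml S params pre body"
    and "A \<in> Hon"
    and "bitml.reachable Hon S params pre body \<Gamma>"
    and "x \<in> \<X>" and "\<X> \<subseteq> cn \<Gamma>"
    and "liquid (bitml.astep S body A) acn alabels (abs_config S A \<X> \<Gamma>) x"
  shows "liquid (bitml.cstep Hon S params pre body) cn (clabels A) \<Gamma> x"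
  using assms(2-) by (rule bitml.abstract_liquid_imp_liquid[OF assms(1)])

end
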